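(* Let $\mathcal I=\{I\subseteq\{1,\dots,n\}\mid \text{the induced subdiagram on }\{\alpha_i\mid i\in I\}\cup\{-\lambda\}\text{ of the extended Dynkin diagram is connected}\}$, and let $J=\{j\in\{1,\dots,n\}\mid(\lambda,\alpha_j)=0\}$ be the type of $\lambda$. For $I\in\mathcal I$ let $I^*=I\cup\{j\in J\mid(\alpha_j,\alpha_i)=0\text{ for all } i\in I\}$. Then the $f$-polynomial of $\mathbf P$ is $$\sum_{I\in\mathcal I}\frac{|W|}{|W_{I^*}|}\,t^{|I|}.$$
   Context: Let $\mathfrak g$ be a finite-dimensional complex simple Lie algebra with root system $\Phi$, base $\Pi=\{\alpha_1,\dots,\alpha_n\}$, Weyl group $W$; $E$ is the real span of $\Pi$ with $W$-invariant inner product $(\cdot,\cdot)$. Let $\lambda$ be a dominant integral weight and $\mathbf P=\mathrm{conv}(W\lambda)$ its weight polytope. For $K\subseteq\{1,\dots,n\}$, $W_K$ is the subgroup of $W$ generated by $s_{\alpha_k}$, $k\in K$. The extended Dynkin diagram is the Dynkin diagram of $\Pi$ with an extra node $\{-\lambda\}$ joined by a single edge to $\alpha_i$ iff $(\lambda,\alpha_i)>0$. The $f$-polynomial of $\mathbf P$ is $\sum_{k\ge0}f_k t^k$ where $f_k$ is the number of $k$-dimensional faces of $\mathbf P$. *)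

theory Defs
  imports "HOL-Analysis.Analysis" "HOL-Computational_Algebra.Polynomial"
begin

definition refl :: "'a::euclidean_space \<Rightarrow> 'a \<Rightarrow> 'a" where
  "refl a v = v - ((2 * (v \<bullet> a)) / (a \<bullet> a)) *\<^sub>R a"

text \<open>Group of maps generated by a set S of involutions (under composition).\<close>
inductive_set gen_group :: "('a \<Rightarrow> 'a) set \<Rightarrow> ('a \<Rightarrow> 'a) set" for S where
  gen_id: "id \<in> gen_group S"
| gen_step: "s \<in> S \<Longrightarrow> w \<in> gen_group S \<Longrightarrow> s \<circ> w \<in> gen_group S"

definition root_system :: "'a::euclidean_space set \<Rightarrow> bool" where
  "root_system \<Phi> \<longleftrightarrow> finite \<Phi> \<and> 0 \<notin> \<Phi> \<and> span \<Phi> = UNIV \<and>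
     (\<forall>\<alpha>\<in>\<Phi>. refl \<alpha> ` \<Phi> = \<Phi>) \<and>
     (\<forall>\<alpha>\<in>\<Phi>. \<forall>\<beta>\<in>\<Phi>. 2 * (\<beta> \<bullet> \<alpha>) / (\<alpha> \<bullet> \<alpha>) \<in> \<int>) \<and>
     (\<forall>\<alpha>\<in>\<Phi>. \<forall>c::real. c *\<^sub>R \<alpha> \<in> \<Phi> \<longrightarrow> c = 1 \<or> c = -1)"

definition irreducible_rs :: "'a::euclidean_space set \<Rightarrow> bool" where
  "irreducible_rs \<Phi> \<longleftrightarrow> \<not> (\<exists>A B. A \<noteq> {} \<and> B \<noteq> {} \<and> A \<union> B = \<Phi> \<and> A \<inter> B = {} \<and>
                              (\<forall>a\<in>A. \<forall>b\<in>B. a \<bullet> b = 0))"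

definition is_base :: "'a::euclidean_space set \<Rightarrow> nat \<Rightarrow> (nat \<Rightarrow> 'a) \<Rightarrow> bool" where
  "is_base \<Phi> n alpha \<longleftrightarrow> inj_on alpha {1..n} \<and> alpha ` {1..n} \<subseteq> \<Phi> \<and>
     independent (alpha ` {1..n}) \<and>
     (\<forall>\<beta>\<in>\<Phi>. \<exists>c::nat \<Rightarrow> int.
        ((\<forall>i\<in>{1..n}. c i \<ge> 0) \<or> (\<forall>i\<in>{1..n}. c i \<le> 0)) \<and>
        \<beta> = (\<Sum>i\<in>{1..n}. of_int (c i) *\<^sub>R alpha i))"

definition weyl_group :: "'a::euclidean_space set \<Rightarrow> ('a \<Rightarrow> 'a) set" where
  "weyl_group \<Phi> = gen_group (refl ` \<Phi>)"

definition parabolic :: "(nat \<Rightarrow> 'a::euclidean_space) \<Rightarrow> nat set \<Rightarrow> ('a \<Rightarrow> 'a) set" where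
  "parabolic alpha K = gen_group ((\<lambda>k. refl (alpha k)) ` K)"

definition dominant_integral :: "nat \<Rightarrow> (nat \<Rightarrow> 'a::euclidean_space) \<Rightarrow> 'a \<Rightarrow> bool" where
  "dominant_integral n alpha lam \<longleftrightarrow>
     (\<forall>i\<in>{1..n}. \<exists>m::nat. 2 * (lam \<bullet> alpha i) / (alpha i \<bullet> alpha i) = real m)"

definition weight_polytope :: "'a::euclidean_space set \<Rightarrow> 'a \<Rightarrow> 'a set" where
  "weight_polytope \<Phi> lam = convex hull ((\<lambda>w. w lam) ` weyl_group \<Phi>)"

text \<open>Extended Dynkin diagram: node None is -lambda, node Some i is alpha i.\<close>
fun ext_adj :: "(nat \<Rightarrow> 'a::euclidean_space) \<Rightarrow> 'a \<Rightarrow> nat option \<Rightarrow> nat option \<Rightarrow> bool" where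
  "ext_adj alpha lam None None = False"
| "ext_adj alpha lam None (Some i) = (lam \<bullet> alpha i > 0)"
| "ext_adj alpha lam (Some i) None = (lam \<bullet> alpha i > 0)"
| "ext_adj alpha lam (Some i) (Some j) = (i \<noteq> j \<and> alpha i \<bullet> alpha j \<noteq> 0)"

definition ext_connected :: "(nat \<Rightarrow> 'a::euclidean_space) \<Rightarrow> 'a \<Rightarrow> nat set \<Rightarrow> bool" where
  "ext_connected alpha lam I \<longleftrightarrow>
     (let V = insert None (Some ` I) in
      \<forall>v\<in>V. (\<lambda>x y. x \<in> V \<and> y \<in> V \<and> ext_adj alpha lam x y)\<^sup>*\<^sup>* None v)"

definition conn_sets :: "nat \<Rightarrow> (nat \<Rightarrow> 'a::euclidean_space) \<Rightarrow> 'a \<Rightarrow> nat set set" where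
  "conn_sets n alpha lam = {I. I \<subseteq> {1..n} \<and> ext_connected alpha lam I}"

definition lam_type :: "nat \<Rightarrow> (nat \<Rightarrow> 'a::euclidean_space) \<Rightarrow> 'a \<Rightarrow> nat set" where
  "lam_type n alpha lam = {j\<in>{1..n}. lam \<bullet> alpha j = 0}"

definition star_set :: "nat \<Rightarrow> (nat \<Rightarrow> 'a::euclidean_space) \<Rightarrow> 'a \<Rightarrow> nat set \<Rightarrow> nat set" where
  "star_set n alpha lam I = I \<union> {j\<in>lam_type n alpha lam. \<forall>i\<in>I. alpha j \<bullet> alpha i = 0}"

definition f_poly :: "'a::euclidean_space set \<Rightarrow> real poly" where
  "f_poly P = (\<Sum>k\<le>DIM('a). monom (real (card {F. F face_of P \<and> aff_dim F = int k})) k)"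

end

theory Submission
  imports Defs
begin

text \<open>
  Every nonempty face of the polytope is cut out by a supporting functional, which up to the Weyl
  group can be taken dominant; if \<open>K\<close> is the set of simple roots on which it vanishes, the face is
  the convex hull of the orbit of \<open>\<lambda>\<close> under \<open>W\<^sub>K\<close>, and only the component \<open>I\<close> of \<open>-\<lambda>\<close> in
  \<open>K \<union> {-\<lambda>}\<close> matters for this orbit. The centroid \<open>c\<close> of the vertices of such a standard face is
  dominant, \<open>\<lambda> - c\<close> has support exactly \<open>I\<close>, and \<open>c\<close> is orthogonal exactly to the simple roots in
  \<open>I\<^sup>*\<close>. Since a dominant vector is alone in its orbit among the dominant ones and has a parabolic
  stabilizer, standard faces for different \<open>I\<close> are not conjugate and the stabilizer of the face of
  \<open>I\<close> is the parabolic subgroup of \<open>I\<^sup>*\<close>. Orbit counting gives the formula.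
\<close>

section \<open>Reflections and generated groups\<close>

lemma linear_refl: "linear (refl a)"
  by (rule linearI) (simp_all add: refl_def inner_simps add_divide_distrib algebra_simps)

lemma refl_inner_self: "refl a v \<bullet> a = - (v \<bullet> a)"
  by (cases "a = 0") (simp_all add: refl_def inner_diff_left)

lemma refl_refl [simp]: "refl a (refl a v) = v"
  unfolding refl_def[of a "refl a v"] refl_inner_self by (simp add: refl_def)

lemma refl_comp_refl [simp]: "refl a \<circ> refl a = id"
  by auto

lemma refl_self [simp]: "refl a a = - a"
  by (cases "a = 0") (auto simp: refl_def algebra_simps scaleR_2)

lemma refl_uminus_left [simp]: "refl (- a) = refl a"
  by (auto simp: refl_def)

lemma refl_fix: "v \<bullet> a = 0 \<Longrightarrow> refl a v = v"
  by (simp add: refl_def)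

lemma orthogonal_transformation_refl: "orthogonal_transformation (refl a)"
proof -
  have "refl a x \<bullet> refl a y = x \<bullet> y" for x y
    by (cases "a = 0") (auto simp: refl_def inner_simps inner_commute field_simps)
  then show ?thesis by (simp add: orthogonal_transformation_def linear_refl)
qed

lemma orthogonal_transformation_refl_conj:
  assumes "orthogonal_transformation u"
  shows "u (refl a x) = refl (u a) (u x)"
proof -
  have "linear u" "\<And>x y. u x \<bullet> u y = x \<bullet> y"
    using assms by (auto simp: orthogonal_transformation_def)
  then show ?thesis
    by (simp add: refl_def linear_diff linear_scale)
qed

lemma gen_group_incl: "s \<in> S \<Longrightarrow> s \<in> gen_group S"
  using gen_step[of s S id] gen_id by auto

lemma gen_group_comp:
  assumes "u \<in> gen_group S" "w \<in> gen_group S"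
  shows "u \<circ> w \<in> gen_group S"
  using assms by (induction rule: gen_group.induct) (auto intro: gen_step simp: comp_assoc)

lemma gen_group_subset:
  assumes "S \<subseteq> gen_group T"
  shows "gen_group S \<subseteq> gen_group T"
proof
  fix w assume "w \<in> gen_group S"
  then show "w \<in> gen_group T"
  proof induction
    case gen_id
    show ?case by (rule gen_group.gen_id)
  next
    case (gen_step s w)
    with assms show ?case by (blast intro: gen_group_comp)
  qed
qed

lemma gen_group_mono: "S \<subseteq> T \<Longrightarrow> gen_group S \<subseteq> gen_group T"
  by (intro gen_group_subset) (auto intro: gen_group_incl)

text \<open>By construction \<open>gen_group\<close> is only closed under products. As the
  generators are involutions, reversing a product inverts it, so it is a group.\<close>

lemma gen_group_inverse:
  assumes inv: "\<And>s. s \<in> S \<Longrightarrow> s \<circ> s = id" and "w \<in> gen_group S"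
  obtains w' where "w' \<in> gen_group S" "w' \<circ> w = id" "w \<circ> w' = id"
proof -
  have "\<exists>w'\<in>gen_group S. w' \<circ> w = id \<and> w \<circ> w' = id"
    using assms(2)
  proof induction
    case gen_id
    show ?case by (rule bexI[of _ id]) (simp_all add: gen_group.gen_id)
  next
    case (gen_step s w)
    then obtain w' where w': "w' \<in> gen_group S" "w' \<circ> w = id" "w \<circ> w' = id" by blast
    have "(w' \<circ> s) \<circ> (s \<circ> w) = w' \<circ> (s \<circ> s) \<circ> w"
      and "(s \<circ> w) \<circ> (w' \<circ> s) = s \<circ> (w \<circ> w') \<circ> s" by (auto simp: comp_assoc)
    then have "(w' \<circ> s) \<circ> (s \<circ> w) = id" "(s \<circ> w) \<circ> (w' \<circ> s) = id"
      using w' inv[OF gen_step(1)] by simp_all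
    moreover have "w' \<circ> s \<in> gen_group S"
      using w' gen_step(1) by (blast intro: gen_group_comp gen_group_incl)
    ultimately show ?case by blast
  qed
  then show thesis using that by blast
qed

lemma orthogonal_transformation_gen_group:
  assumes "w \<in> gen_group S" "\<And>s. s \<in> S \<Longrightarrow> orthogonal_transformation s"
  shows "orthogonal_transformation w"
  using assms
  by induction (auto intro: orthogonal_transformation_compose simp: orthogonal_transformation_id id_def)

section \<open>Parabolic subgroups\<close>

locale based_root_system =
  fixes \<Phi> :: "'a::euclidean_space set" and n :: nat and alpha :: "nat \<Rightarrow> 'a"
  assumes root_system: "root_system \<Phi>"
    and base: "is_base \<Phi> n alpha"
begin

(* Otherwise the simplifier turns the index set {1..n} into {Suc 0..n}. *)
declare One_nat_def [simp del]

section \<open>Coordinates in the base and positivity of roots\<close>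

definition coord :: "nat \<Rightarrow> 'a \<Rightarrow> real" where
  "coord i v = representation (alpha ` {1..n}) v (alpha i)"

abbreviation s :: "nat \<Rightarrow> 'a \<Rightarrow> 'a" where "s i \<equiv> refl (alpha i)"

abbreviation W :: "nat set \<Rightarrow> ('a \<Rightarrow> 'a) set" where "W \<equiv> parabolic alpha"

text \<open>Relative to \<open>K\<close>, so that the conjugacy results below serve each
  \<open>W K\<close> and not only the full group.\<close>

definition dominant_on :: "nat set \<Rightarrow> 'a \<Rightarrow> bool" where
  "dominant_on K v \<longleftrightarrow> (\<forall>i\<in>K. v \<bullet> alpha i \<ge> 0)"

lemma finite_roots: "finite \<Phi>"
  and root_nonzero: "\<beta> \<in> \<Phi> \<Longrightarrow> \<beta> \<noteq> 0"
  and span_roots: "span \<Phi> = UNIV"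
  and refl_root: "\<gamma> \<in> \<Phi> \<Longrightarrow> \<beta> \<in> \<Phi> \<Longrightarrow> refl \<gamma> \<beta> \<in> \<Phi>"
  and root_reduced: "\<beta> \<in> \<Phi> \<Longrightarrow> c *\<^sub>R \<beta> \<in> \<Phi> \<Longrightarrow> c = 1 \<or> c = -1"
  using root_system unfolding root_system_def by blast+

lemma inj_alpha: "inj_on alpha {1..n}"
  and independent_alpha: "independent (alpha ` {1..n})"
  and alpha_root: "i \<in> {1..n} \<Longrightarrow> alpha i \<in> \<Phi>"
  using base unfolding is_base_def by blast+

lemma alpha_inner_pos: "i \<in> {1..n} \<Longrightarrow> alpha i \<bullet> alpha i > 0"
  using alpha_root root_nonzero by force

lemma span_alpha: "span (alpha ` {1..n}) = UNIV"
proof -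
  have "\<beta> \<in> span (alpha ` {1..n})" if "\<beta> \<in> \<Phi>" for \<beta>
  proof -
    obtain c :: "nat \<Rightarrow> int" where c: "\<beta> = (\<Sum>i\<in>{1..n}. of_int (c i) *\<^sub>R alpha i)"
      using base \<open>\<beta> \<in> \<Phi>\<close> unfolding is_base_def by blast
    show ?thesis unfolding c by (intro span_sum span_scale span_base imageI)
  qed
  then have "span \<Phi> \<subseteq> span (alpha ` {1..n})"
    by (intro span_minimal) auto
  then show ?thesis using span_roots by auto
qed

lemma linear_coord: "linear (coord i)"
  unfolding coord_def
  by (rule linearI) (simp_all add: representation_add representation_scale independent_alpha span_alpha)

lemmas coord_simps [simp] =
  linear_add[OF linear_coord] linear_diff[OF linear_coord] linear_neg[OF linear_coord]
  linear_scale[OF linear_coord] linear_0[OF linear_coord]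

lemmas coord_sum = linear_sum[OF linear_coord]

lemma coord_alpha: "i \<in> {1..n} \<Longrightarrow> j \<in> {1..n} \<Longrightarrow> coord i (alpha j) = (if i = j then 1 else 0)"
  by (simp add: coord_def representation_basis[OF independent_alpha] inj_on_eq_iff[OF inj_alpha])

lemma coord_expand: "v = (\<Sum>i\<in>{1..n}. coord i v *\<^sub>R alpha i)"
proof -
  have "v = (\<Sum>b\<in>alpha ` {1..n}. representation (alpha ` {1..n}) v b *\<^sub>R b)"
    by (rule sum_representation_eq[symmetric]) (auto simp: independent_alpha span_alpha)
  also have "\<dots> = (\<Sum>i\<in>{1..n}. coord i v *\<^sub>R alpha i)"
    by (simp add: sum.reindex[OF inj_alpha] coord_def)
  finally show ?thesis .
qed

lemma inner_expand: "v \<bullet> x = (\<Sum>i\<in>{1..n}. coord i v * (alpha i \<bullet> x))"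
  by (subst coord_expand[of v]) (simp add: inner_sum_left)

lemma coord_eqI: "(\<And>i. i \<in> {1..n} \<Longrightarrow> coord i v = coord i w) \<Longrightarrow> v = w"
  using coord_expand[of v] coord_expand[of w] by simp

lemma root_pos_or_neg:
  assumes "\<beta> \<in> \<Phi>"
  shows "(\<forall>i\<in>{1..n}. coord i \<beta> \<ge> 0) \<or> (\<forall>i\<in>{1..n}. coord i \<beta> \<le> 0)"
proof -
  obtain c :: "nat \<Rightarrow> int" where
    c: "(\<forall>i\<in>{1..n}. c i \<ge> 0) \<or> (\<forall>i\<in>{1..n}. c i \<le> 0)" "\<beta> = (\<Sum>i\<in>{1..n}. of_int (c i) *\<^sub>R alpha i)"
    using base assms unfolding is_base_def by blast
  have "coord j \<beta> = of_int (c j)" if "j \<in> {1..n}" for j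
  proof -
    have "coord j \<beta> = (\<Sum>i\<in>{1..n}. if i = j then of_int (c i) else 0)"
      unfolding c(2) coord_sum using that by (intro sum.cong) (auto simp: coord_alpha)
    then show ?thesis using that by simp
  qed
  then show ?thesis using c(1) by auto
qed

lemma coord_s: "i \<in> {1..n} \<Longrightarrow> j \<in> {1..n} \<Longrightarrow> i \<noteq> j \<Longrightarrow> coord i (s j v) = coord i v"
  by (simp add: refl_def coord_alpha)

text \<open>By reducedness a positive root other than \<open>alpha j\<close> has a positive
  coordinate away from \<open>j\<close>. The reflection \<open>s j\<close> keeps that coordinate,
  and one positive coordinate already rules out a negative root.\<close>

lemma s_root_pos:
  assumes "\<beta> \<in> \<Phi>" "\<forall>i\<in>{1..n}. coord i \<beta> \<ge> 0" "j \<in> {1..n}" "\<beta> \<noteq> alpha j"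
  shows "\<forall>i\<in>{1..n}. coord i (s j \<beta>) \<ge> 0"
proof -
  have "\<exists>i\<in>{1..n}. i \<noteq> j \<and> coord i \<beta> > 0"
  proof (rule ccontr)
    assume "\<not> ?thesis"
    then have zero: "coord i \<beta> = 0" if "i \<in> {1..n}" "i \<noteq> j" for i
      using assms(2) that by (meson antisym not_less)
    define c where "c = coord j \<beta>"
    have \<beta>: "\<beta> = c *\<^sub>R alpha j"
      using assms(3) zero by (intro coord_eqI) (simp add: coord_alpha c_def)
    have "c *\<^sub>R alpha j \<in> \<Phi>" using assms(1) unfolding \<beta> .
    then have "c = 1 \<or> c = -1" using root_reduced alpha_root[OF assms(3)] by blast
    moreover have "c \<ge> 0" using assms(2,3) by (simp add: c_def)
    ultimately have "c = 1" by linarith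
    with \<beta> have "\<beta> = alpha j" by simp
    with assms(4) show False by simp
  qed
  then obtain i where "i \<in> {1..n}" "coord i (s j \<beta>) > 0"
    using assms(3) coord_s by metis
  moreover have "s j \<beta> \<in> \<Phi>" using assms(1,3) alpha_root refl_root by blast
  ultimately show ?thesis using root_pos_or_neg[of "s j \<beta>"] linorder_not_less by metis
qed

text \<open>The root \<open>s j (alpha i)\<close> is still positive, and its coordinate at
  \<open>j\<close> is minus the Cartan number of the pair.\<close>

lemma alpha_obtuse:
  assumes "i \<in> {1..n}" "j \<in> {1..n}" "i \<noteq> j"
  shows "alpha i \<bullet> alpha j \<le> 0"
proof -
  have "alpha i \<noteq> alpha j" using assms by (simp add: inj_on_eq_iff[OF inj_alpha])
  then have "\<forall>k\<in>{1..n}. coord k (s j (alpha i)) \<ge> 0"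
    by (intro s_root_pos) (use assms in \<open>simp_all add: alpha_root coord_alpha\<close>)
  then have "coord j (s j (alpha i)) \<ge> 0" using assms(2) by blast
  moreover have "coord j (s j (alpha i)) = - (2 * (alpha i \<bullet> alpha j) / (alpha j \<bullet> alpha j))"
    using assms by (simp add: refl_def coord_alpha)
  ultimately show ?thesis using alpha_inner_pos[OF assms(2)] by (simp add: field_simps)
qed

lemma id_W [simp]: "id \<in> W K"
  by (simp add: parabolic_def gen_id)

lemma s_in_W: "i \<in> K \<Longrightarrow> s i \<in> W K"
  unfolding parabolic_def by (auto intro: gen_group_incl)

lemma W_comp: "u \<in> W K \<Longrightarrow> w \<in> W K \<Longrightarrow> u \<circ> w \<in> W K"
  unfolding parabolic_def by (rule gen_group_comp)

lemma W_mono: "K \<subseteq> L \<Longrightarrow> W K \<subseteq> W L"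
  unfolding parabolic_def by (intro gen_group_mono) auto

lemma W_inverse:
  assumes "w \<in> W K"
  obtains w' where "w' \<in> W K" "w' \<circ> w = id" "w \<circ> w' = id"
proof (rule gen_group_inverse[OF _ assms[unfolded parabolic_def]])
  fix r assume "r \<in> s ` K"
  then show "r \<circ> r = id" using refl_comp_refl by blast
next
  fix w' assume "w' \<in> gen_group (s ` K)" "w' \<circ> w = id" "w \<circ> w' = id"
  then show thesis using that unfolding parabolic_def by blast
qed

lemma W_induct [consumes 1, case_names id step]:
  assumes "w \<in> W K" "P id" "\<And>i w. i \<in> K \<Longrightarrow> w \<in> W K \<Longrightarrow> P w \<Longrightarrow> P (s i \<circ> w)"
  shows "P w"
  using assms(1) unfolding parabolic_def
proof (induction rule: gen_group.induct)
  case gen_id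
  show ?case by (rule assms(2))
next
  case (gen_step r w)
  then obtain k where k: "r = s k" "k \<in> K" by blast
  have "w \<in> W K" unfolding parabolic_def by (rule gen_step.hyps)
  from assms(3)[OF k(2) this gen_step.IH] show ?case unfolding k(1) .
qed

lemma W_orthogonal: "w \<in> W K \<Longrightarrow> orthogonal_transformation w"
  unfolding parabolic_def
  by (erule orthogonal_transformation_gen_group) (clarsimp simp: orthogonal_transformation_refl)

lemma W_linear: "w \<in> W K \<Longrightarrow> linear w"
  and W_inner: "w \<in> W K \<Longrightarrow> w x \<bullet> w y = x \<bullet> y"
  using W_orthogonal[of w K] by (simp_all add: orthogonal_transformation_def)

lemma W_root:
  assumes "w \<in> W K" "K \<subseteq> {1..n}" "\<beta> \<in> \<Phi>"
  shows "w \<beta> \<in> \<Phi>"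
  using assms(1)
proof (induction rule: W_induct)
  case id
  show ?case using assms by simp
next
  case (step i w)
  then have "alpha i \<in> \<Phi>" using assms(2) alpha_root by blast
  from refl_root[OF this step.IH] show ?case by simp
qed

text \<open>Each generator shifts a vector by a multiple of some \<open>alpha j\<close> with
  \<open>j\<close> in \<open>K\<close>.\<close>

lemma W_coord:
  assumes "w \<in> W K" "K \<subseteq> {1..n}" "i \<in> {1..n} - K"
  shows "coord i (w x) = coord i x"
  using assms(1)
proof (induction rule: W_induct)
  case id
  show ?case by simp
next
  case (step j w)
  then have "j \<in> {1..n}" "i \<in> {1..n}" "i \<noteq> j" using assms(2,3) by blast+
  from coord_s[OF this(2,1,3), of "w x"] step.IH show ?case by (simp only: comp_apply)
qed

section \<open>Words in the simple reflections and the exchange condition\<close>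

definition word :: "nat list \<Rightarrow> 'a \<Rightarrow> 'a" where
  "word js = foldr (\<lambda>i f. s i \<circ> f) js id"

lemma word_simps [simp]: "word [] = id" "word (j # js) = s j \<circ> word js"
  by (simp_all add: word_def)

lemma word_snoc: "word (js @ [j]) = word js \<circ> s j"
  by (induction js) auto

lemma word_in_W: "set js \<subseteq> K \<Longrightarrow> word js \<in> W K"
  by (induction js) (simp_all add: W_comp s_in_W)

lemma W_word: "w \<in> W K \<Longrightarrow> \<exists>js. set js \<subseteq> K \<and> w = word js"
proof (induction rule: W_induct)
  case id
  show ?case by (rule exI[of _ "[]"]) simp
next
  case (step i w)
  from step.IH obtain js where js: "set js \<subseteq> K" "w = word js" by (elim exE conjE)
  from js(1) step.hyps(1) have "set (i # js) \<subseteq> K" by simp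
  moreover have "s i \<circ> w = word (i # js)" unfolding js(2) word_simps ..
  ultimately show ?case by (rule exI[of _ "i # js", OF conjI])
qed

text \<open>The letters act on \<open>alpha i\<close> from the right end of the word. As the final
  root is negative, some letter \<open>j\<close> turns a positive root into a negative one; that
  root must be \<open>alpha j\<close>, and conjugation lets this letter cancel against
  \<open>s i\<close>.\<close>

lemma word_exchange:
  assumes "set js \<subseteq> {1..n}" "i \<in> {1..n}" "\<forall>k\<in>{1..n}. coord k (word js (alpha i)) \<le> 0"
  shows "\<exists>ks. set ks \<subseteq> set js \<and> length ks < length js \<and> word js \<circ> s i = word ks"
  using assms
proof (induction js)
  case Nil
  then have "coord i (alpha i) \<le> 0" by auto
  then show ?case using Nil by (simp add: coord_alpha)
next
  case (Cons j js)
  let ?\<beta> = "word js (alpha i)"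
  have w: "word js \<in> W {1..n}" using Cons by (intro word_in_W) auto
  have root: "?\<beta> \<in> \<Phi>" using W_root[OF w] alpha_root Cons by auto
  show ?case
  proof (cases "\<forall>k\<in>{1..n}. coord k ?\<beta> \<le> 0")
    case True
    have "set js \<subseteq> {1..n}" using Cons.prems(1) by simp
    from Cons.IH[OF this Cons.prems(2) True] obtain ks
      where ks: "set ks \<subseteq> set js" "length ks < length js" "word js \<circ> s i = word ks" by blast
    then have "word (j # js) \<circ> s i = word (j # ks)" by (simp only: word_simps comp_assoc)
    moreover have "set (j # ks) \<subseteq> set (j # js)" "length (j # ks) < length (j # js)"
      using ks(1,2) by auto
    ultimately show ?thesis by (intro exI[of _ "j # ks"] conjI)
  next
    case False
    then have pos: "\<forall>k\<in>{1..n}. coord k ?\<beta> \<ge> 0" using root_pos_or_neg[OF root] by auto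
    have "?\<beta> = alpha j"
    proof (rule ccontr)
      assume "?\<beta> \<noteq> alpha j"
      then have "\<forall>k\<in>{1..n}. coord k (s j ?\<beta>) \<ge> 0" using s_root_pos root pos Cons by auto
      \<comment> \<open>Nonnegative coordinates by \<open>s_root_pos\<close>, nonpositive ones by
        the assumption on the whole word.\<close>
      with Cons have "s j ?\<beta> = 0" by (intro coord_eqI) (force intro: antisym)
      moreover have "s j ?\<beta> \<in> \<Phi>" using root alpha_root refl_root Cons by auto
      ultimately show False using root_nonzero by auto
    qed
    \<comment> \<open>Now \<open>s j\<close> is the conjugate of \<open>s i\<close> by
      \<open>word js\<close>, so the two reflections cancel.\<close>
    then have "word (j # js) \<circ> s i = word js"
      using orthogonal_transformation_refl_conj[OF W_orthogonal[OF w], of "alpha i"] by auto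
    then show ?thesis by (intro exI[of _ js] conjI) (simp_all only: list.set length_Cons subset_insertI lessI)
  qed
qed

text \<open>By the exchange lemma a shortest word of \<open>w\<close> ends in a reflection that \<open>w\<close> inverts, so the
  induction step may assume that the prefix keeps the last simple root positive.\<close>
lemma W_reduced_induct [consumes 2, case_names id step]:
  assumes "w \<in> W K" "K \<subseteq> {1..n}" "P id"
    and step: "\<And>u i. u \<in> W K \<Longrightarrow> i \<in> K \<Longrightarrow> \<forall>k\<in>{1..n}. coord k (u (alpha i)) \<ge> 0 \<Longrightarrow> P u \<Longrightarrow> P (u \<circ> s i)"
  shows "P w"
proof -
  have "P (word js)" if "set js \<subseteq> K" for js
    using that
  proof (induction "length js" arbitrary: js rule: less_induct)
    case less
    show ?case
    proof (cases js rule: rev_cases)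
      case Nil
      then show ?thesis using assms by simp
    next
      case (snoc ls i)
      then have i: "i \<in> K" "set ls \<subseteq> K" "i \<in> {1..n}" using less assms by auto
      have "word ls (alpha i) \<in> \<Phi>"
        using i assms alpha_root W_root word_in_W by metis
      then consider "\<forall>k\<in>{1..n}. coord k (word ls (alpha i)) \<ge> 0"
        | "\<forall>k\<in>{1..n}. coord k (word ls (alpha i)) \<le> 0"
        using root_pos_or_neg by blast
      then show ?thesis
      proof cases
        case 1
        then show ?thesis using step[OF word_in_W[OF i(2)] i(1) 1] less i snoc by (simp add: word_snoc)
      next
        case 2
        have "set ls \<subseteq> {1..n}" using i assms by blast
        from word_exchange[OF this i(3) 2] obtain ks where
          "set ks \<subseteq> set ls" "length ks < length ls" "word ls \<circ> s i = word ks" by blast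
        then show ?thesis using less i snoc by (auto simp: word_snoc)
      qed
    qed
  qed
  then show ?thesis using W_word[OF assms(1)] by auto
qed

section \<open>Dominant vectors: order, conjugacy, stabilizers, existence\<close>

lemma dominant_diff:
  assumes "w \<in> W K" "K \<subseteq> {1..n}" "dominant_on K v" "k \<in> {1..n}"
  shows "coord k (v - w v) \<ge> 0"
  using assms(1,2)
proof (induction rule: W_reduced_induct)
  case id
  then show ?case by simp
next
  case (step u i)
  let ?c = "2 * (v \<bullet> alpha i) / (alpha i \<bullet> alpha i)"
  \<comment> \<open>Appending \<open>s i\<close> adds a nonnegative multiple of the positive root
    \<open>u (alpha i)\<close>, so no coordinate of the difference decreases.\<close>
  have "v - u (s i v) = (v - u v) + ?c *\<^sub>R u (alpha i)"
    using W_linear[OF step(1)] by (simp add: refl_def linear_diff linear_scale)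
  then have "coord k (v - u (s i v)) = coord k (v - u v) + ?c * coord k (u (alpha i))"
    by (simp only: coord_simps real_scaleR_def)
  moreover have "?c \<ge> 0" using assms(3) step(2) by (auto simp: dominant_on_def)
  moreover have "coord k (u (alpha i)) \<ge> 0" using step.hyps(3) assms(4) by blast
  ultimately have "coord k (v - u (s i v)) \<ge> coord k (v - u v)"
    using mult_nonneg_nonneg by (simp only: le_add_same_cancel1)
  with step.IH show ?case unfolding comp_apply by linarith
qed

text \<open>If \<open>u\<close> keeps \<open>alpha i\<close> positive, then
  \<open>u \<circ> s i\<close> makes it negative, and dominance of both \<open>v\<close> and its
  image forces \<open>v \<bullet> alpha i = 0\<close>. So \<open>s i\<close> fixes \<open>v\<close>
  and can be peeled off, which leaves the same claim for \<open>u\<close>.\<close>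

lemma dominant_conjugate_stab:
  assumes "w \<in> W K" "K \<subseteq> {1..n}" "dominant_on K v" "dominant_on K (w v)"
  shows "w v = v" "w \<in> W {i\<in>K. v \<bullet> alpha i = 0}"
proof -
  have "dominant_on K (w v) \<longrightarrow> w v = v \<and> w \<in> W {i\<in>K. v \<bullet> alpha i = 0}"
    using assms(1,2)
  proof (induction rule: W_reduced_induct)
    case id
    show ?case by (intro impI conjI id_W id_apply)
  next
    case (step u i)
    let ?w = "u \<circ> s i"
    show ?case
    proof
      assume dom: "dominant_on K (?w v)"
      have w: "?w \<in> W K" using step by (auto intro: W_comp s_in_W)
      have i: "i \<in> {1..n}" using step assms by auto
      have neg: "?w (alpha i) = - u (alpha i)"
        using W_linear[OF step(1)] by (simp add: linear_neg)
      have "v \<bullet> alpha i = ?w v \<bullet> ?w (alpha i)" by (rule W_inner[OF w, symmetric])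
      also have "\<dots> = - (\<Sum>k\<in>{1..n}. coord k (u (alpha i)) * (alpha k \<bullet> ?w v))"
        unfolding neg inner_minus_right by (subst inner_commute, subst inner_expand) simp
      also have "\<dots> \<le> 0"
      proof -
        have "coord k (u (alpha i)) * (alpha k \<bullet> ?w v) \<ge> 0" if "k \<in> {1..n}" for k
        proof (cases "k \<in> K")
          case True
          then show ?thesis using dom step that by (auto simp: dominant_on_def inner_commute)
        next
          case False
          \<comment> \<open>Dominance of the image is known on \<open>K\<close> only; outside
            \<open>K\<close> the terms vanish because \<open>u\<close> leaves those coordinates of
            \<open>alpha i\<close> at zero.\<close>
          then have "coord k (u (alpha i)) = coord k (alpha i)"
            using W_coord[OF step(1) assms(2)] that by auto
          also have "\<dots> = 0" using that i step False by (auto simp: coord_alpha)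
          finally show ?thesis by simp
        qed
        then show ?thesis unfolding neg_le_0_iff_le by (rule sum_nonneg)
      qed
      finally have 0: "v \<bullet> alpha i = 0" using assms(3) step by (force simp: dominant_on_def)
      then have fixed: "s i v = v" by (rule refl_fix)
      then have "u v = v \<and> u \<in> W {i\<in>K. v \<bullet> alpha i = 0}" using step dom by simp
      then show "?w v = v \<and> ?w \<in> W {i\<in>K. v \<bullet> alpha i = 0}"
        using fixed 0 step by (auto intro!: W_comp s_in_W)
    qed
  qed
  then show "w v = v" "w \<in> W {i\<in>K. v \<bullet> alpha i = 0}" using assms by auto
qed

text \<open>As the roots span the space, restriction embeds \<open>W K\<close> into the self-maps of
  the finite set \<Phi>.\<close>

lemma finite_W: assumes "K \<subseteq> {1..n}" shows "finite (W K)"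
proof (rule inj_on_finite)
  show "inj_on (\<lambda>w. restrict w \<Phi>) (W K)"
  proof (rule inj_onI)
    fix u w assume uw: "u \<in> W K" "w \<in> W K" "restrict u \<Phi> = restrict w \<Phi>"
    have "u x = w x" for x
    proof (rule linear_eq_on_span[OF W_linear[OF uw(1)] W_linear[OF uw(2)]])
      show "u b = w b" if "b \<in> \<Phi>" for b using uw(3) that by (metis restrict_apply')
      show "x \<in> span \<Phi>" using span_roots by auto
    qed
    then show "u = w" by auto
  qed
  show "(\<lambda>w. restrict w \<Phi>) ` W K \<subseteq> \<Phi> \<rightarrow>\<^sub>E \<Phi>"
    using W_root[OF _ assms] by auto
  show "finite (\<Phi> \<rightarrow>\<^sub>E \<Phi>)" using finite_roots by (intro finite_PiE) auto
qed

text \<open>Choose \<open>w\<close> so that the height (coordinate sum) of \<open>w v\<close> is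
  maximal; a negative pairing with \<open>alpha j\<close> would let \<open>s j\<close> raise
  it.\<close>

lemma ex_dominant:
  assumes "K \<subseteq> {1..n}"
  obtains w where "w \<in> W K" "dominant_on K (w v)"
proof -
  let ?h = "\<lambda>w. \<Sum>i\<in>{1..n}. coord i (w v)"
  have "finite (?h ` W K)" "?h ` W K \<noteq> {}" using finite_W[OF assms] id_W by blast+
  from Max_in[OF this] obtain w where w: "w \<in> W K" "?h w = Max (?h ` W K)" by auto
  then have max: "?h u \<le> ?h w" if "u \<in> W K" for u
    using Max_ge[OF \<open>finite (?h ` W K)\<close> imageI[of u]] that by (simp only:)
  have "w v \<bullet> alpha j \<ge> 0" if j: "j \<in> K" for j
  proof (rule ccontr)
    assume neg: "\<not> w v \<bullet> alpha j \<ge> 0"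
    have jn: "j \<in> {1..n}" using j assms by auto
    let ?c = "2 * (w v \<bullet> alpha j) / (alpha j \<bullet> alpha j)"
    have "?h (s j \<circ> w) = (\<Sum>i\<in>{1..n}. coord i (w v) - (if i = j then ?c else 0))"
      using jn by (intro sum.cong) (auto simp: refl_def coord_alpha)
    also have "\<dots> = ?h w - ?c" using jn by (simp add: sum_subtractf)
    finally have "?h (s j \<circ> w) = ?h w - ?c" .
    moreover have "?c < 0" using neg alpha_inner_pos[OF jn] by (auto simp: field_simps)
    moreover have "s j \<circ> w \<in> W K" using w j by (auto intro: W_comp s_in_W)
    ultimately show False using max[of "s j \<circ> w"] by linarith
  qed
  then have "dominant_on K (w v)" unfolding dominant_on_def by blast
  with w(1) show thesis by (rule that)
qed

section \<open>The simple reflections generate the Weyl group\<close>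

lemma refl_root_in_W:
  assumes "\<beta> \<in> \<Phi>"
  shows "refl \<beta> \<in> W {1..n}"
proof -
  have pos: "refl \<beta> \<in> W {1..n}" if "\<beta> \<in> \<Phi>" "\<forall>i\<in>{1..n}. coord i \<beta> \<ge> 0" for \<beta>
  proof (rule ccontr)
    \<comment> \<open>A counterexample of least height \<open>h\<close> pairs positively with some
      \<open>alpha i\<close>. Then \<open>s i\<close> makes it a lower positive root, whose
      reflection lies in the group and is conjugate under \<open>s i\<close> to the one
      wanted.\<close>
    define B where "B = {\<beta>\<in>\<Phi>. (\<forall>i\<in>{1..n}. coord i \<beta> \<ge> 0) \<and> refl \<beta> \<notin> W {1..n}}"
    define h where "h = (\<lambda>\<beta>. \<Sum>i\<in>{1..n}. coord i \<beta>)"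
    assume "refl \<beta> \<notin> W {1..n}"
    then have "B \<noteq> {}" "finite B" using that finite_roots by (auto simp: B_def)
    then obtain \<beta> where \<beta>: "\<beta> \<in> B" and min: "\<And>\<gamma>. \<gamma> \<in> B \<Longrightarrow> h \<beta> \<le> h \<gamma>"
      using arg_min_if_finite(1)[of B h] arg_min_least[of B _ h] by blast
    have \<beta>': "\<beta> \<in> \<Phi>" "\<forall>i\<in>{1..n}. coord i \<beta> \<ge> 0" "refl \<beta> \<notin> W {1..n}" using \<beta> by (auto simp: B_def)
    have "\<beta> \<bullet> \<beta> > 0" using root_nonzero \<beta>' by auto
    then have "\<exists>i\<in>{1..n}. coord i \<beta> * (alpha i \<bullet> \<beta>) > 0"
      using inner_expand[of \<beta> \<beta>] sum_nonpos[of "{1..n}" "\<lambda>i. coord i \<beta> * (alpha i \<bullet> \<beta>)"]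
      by (metis not_less)
    then obtain i where i: "i \<in> {1..n}" "coord i \<beta> * (alpha i \<bullet> \<beta>) > 0" by auto
    then have inner: "\<beta> \<bullet> alpha i > 0"
      using \<beta>'(2) by (metis inner_commute mult_le_0_iff not_less zero_less_mult_iff)
    have ne: "\<beta> \<noteq> alpha i" using \<beta>'(3) s_in_W i by auto
    let ?c = "2 * (\<beta> \<bullet> alpha i) / (alpha i \<bullet> alpha i)"
    have "h (s i \<beta>) = (\<Sum>k\<in>{1..n}. coord k \<beta> - (if k = i then ?c else 0))"
      unfolding h_def using i by (intro sum.cong) (auto simp: refl_def coord_alpha)
    also have "\<dots> = h \<beta> - ?c" using i by (simp add: sum_subtractf h_def)
    finally have "h (s i \<beta>) = h \<beta> - ?c" .
    moreover have "?c > 0" using inner alpha_inner_pos[OF i(1)] by simp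
    ultimately have "h (s i \<beta>) < h \<beta>" by linarith
    then have "s i \<beta> \<notin> B" using min by force
    moreover have "s i \<beta> \<in> \<Phi>" using \<beta>' i alpha_root refl_root by auto
    moreover have "\<forall>k\<in>{1..n}. coord k (s i \<beta>) \<ge> 0" using s_root_pos \<beta>' i ne by auto
    ultimately have "refl (s i \<beta>) \<in> W {1..n}" by (auto simp: B_def)
    moreover have "refl \<beta> = s i \<circ> refl (s i \<beta>) \<circ> s i"
      using orthogonal_transformation_refl_conj[OF orthogonal_transformation_refl, of "alpha i"]
      by (auto simp: fun_eq_iff)
    ultimately have "refl \<beta> \<in> W {1..n}" using i by (auto intro!: W_comp s_in_W)
    then show False using \<beta>' by auto
  qed
  \<comment> \<open>A root and its negative have the same reflection, so positive roots
    suffice.\<close>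
  have "- \<beta> \<in> \<Phi>" using refl_root[OF assms assms] by simp
  with pos[of \<beta>] pos[of "- \<beta>"] root_pos_or_neg[OF assms] assms show ?thesis
    by fastforce
qed

lemma weyl_group_eq: "weyl_group \<Phi> = W {1..n}"
proof
  show "weyl_group \<Phi> \<subseteq> W {1..n}"
    unfolding weyl_group_def parabolic_def
    by (intro gen_group_subset) (use refl_root_in_W in \<open>auto simp: parabolic_def\<close>)
  show "W {1..n} \<subseteq> weyl_group \<Phi>"
    unfolding weyl_group_def parabolic_def
    by (intro gen_group_mono) (use alpha_root in auto)
qed

text \<open>Provides, for every \<open>K\<close>, a functional that cuts out
  \<open>stdface K\<close>: the sum of the coordinates outside \<open>K\<close>.\<close>

lemma ex_dominant_zeros:
  assumes "K \<subseteq> {1..n}"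
  obtains v where "dominant_on {1..n} v" "{i\<in>{1..n}. v \<bullet> alpha i = 0} = K"
proof -
  define g where "g = (\<lambda>x. \<Sum>i\<in>{1..n} - K. coord i x)"
  have lin: "linear g" unfolding g_def by (intro linear_compose_sum) (auto simp: linear_coord)
  have g: "g (alpha i) = (if i \<in> K then 0 else 1)" if i: "i \<in> {1..n}" for i
  proof -
    have "g (alpha i) = (\<Sum>k\<in>{1..n} - K. if k = i then 1 else 0)"
      unfolding g_def using i by (intro sum.cong) (auto simp: coord_alpha)
    then show ?thesis using i by simp
  qed
  \<comment> \<open>The vector that represents the real functional \<open>g\<close> through the
    inner product.\<close>
  let ?v = "adjoint g 1"
  have inner: "?v \<bullet> x = g x" for x using adjoint_clauses(2)[OF lin, of 1 x] by simp
  show thesis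
  proof (rule that)
    show "dominant_on {1..n} ?v" unfolding dominant_on_def inner using g by simp
    show "{i\<in>{1..n}. ?v \<bullet> alpha i = 0} = K" unfolding inner using g assms by (auto split: if_splits)
  qed
qed

end

section \<open>Faces of the weight polytope\<close>

locale dominant_weight = based_root_system +
  fixes lam :: 'a
  assumes dominant: "dominant_on {1..n} lam"
begin

definition orb :: "nat set \<Rightarrow> 'a set" where
  "orb K = (\<lambda>w. w lam) ` W K"

abbreviation stdface :: "nat set \<Rightarrow> 'a set" where
  "stdface K \<equiv> convex hull (orb K)"

lemma lam_in_orb: "lam \<in> orb K"
  unfolding orb_def by (rule image_eqI[OF _ id_W]) simp

lemma W_orb:
  assumes "w \<in> W K" "x \<in> orb K"
  shows "w x \<in> orb K"
proof -
  obtain u where u: "u \<in> W K" "x = u lam" using assms(2) unfolding orb_def by blast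
  show ?thesis unfolding orb_def by (rule image_eqI[OF _ W_comp[OF assms(1) u(1)]]) (simp add: u)
qed

lemma W_image_orb:
  assumes "w \<in> W K"
  shows "w ` orb K = orb K"
proof
  show "w ` orb K \<subseteq> orb K" using W_orb[OF assms] by blast
  obtain w' where w': "w' \<in> W K" "w \<circ> w' = id" using W_inverse[OF assms] by metis
  have "x = w (w' x)" for x using fun_cong[OF w'(2), of x] by simp
  then show "orb K \<subseteq> w ` orb K" using W_orb[OF w'(1)] by blast
qed

lemma finite_orb: "K \<subseteq> {1..n} \<Longrightarrow> finite (orb K)"
  unfolding orb_def using finite_W by blast

lemma orb_mono: "K \<subseteq> L \<Longrightarrow> orb K \<subseteq> orb L"
  unfolding orb_def using W_mono by blast

lemma orb_coord_nonneg:
  assumes "x \<in> orb K" "K \<subseteq> {1..n}" "k \<in> {1..n}"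
  shows "coord k (lam - x) \<ge> 0"
proof -
  obtain w where w: "w \<in> W K" "x = w lam" using assms(1) unfolding orb_def by blast
  have "dominant_on K lam" using dominant assms(2) unfolding dominant_on_def by blast
  from dominant_diff[OF w(1) assms(2) this assms(3)] show ?thesis unfolding w(2) .
qed

lemma orb_coord_zero:
  assumes "x \<in> orb K" "K \<subseteq> {1..n}" "k \<in> {1..n} - K"
  shows "coord k (lam - x) = 0"
proof -
  obtain w where w: "w \<in> W K" "x = w lam" using assms(1) unfolding orb_def by blast
  from W_coord[OF w(1) assms(2,3)] show ?thesis unfolding w(2) by simp
qed

text \<open>Distinct simple roots have nonpositive inner products. Applied to \<open>lam - x\<close>
  and \<open>lam - centroid K\<close>, this shows that lowering \<open>lam\<close> away from
  \<open>j\<close> keeps the pairing with \<open>alpha j\<close> nonnegative.\<close>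

lemma inner_alpha_nonpos:
  assumes "\<And>k. k \<in> {1..n} \<Longrightarrow> coord k d \<ge> 0" "j \<in> {1..n}" "coord j d = 0"
  shows "d \<bullet> alpha j \<le> 0"
  unfolding inner_expand[of d]
proof (rule sum_nonpos)
  fix k assume k: "k \<in> {1..n}"
  show "coord k d * (alpha k \<bullet> alpha j) \<le> 0"
  proof (cases "k = j")
    case True
    with assms(3) show ?thesis by simp
  next
    case False
    from mult_nonneg_nonpos[OF assms(1)[OF k] alpha_obtuse[OF k assms(2) this]] show ?thesis .
  qed
qed

text \<open>Converse of \<open>orb_coord_zero\<close>. Make \<open>x\<close> dominant on
  \<open>K\<close> by an element of \<open>W K\<close>; outside \<open>K\<close> the difference from
  \<open>lam\<close> has zero coordinates, so \<open>inner_alpha_nonpos\<close> gives dominance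
  there too. The only dominant point of the full orbit is \<open>lam\<close>.\<close>

lemma orb_support:
  assumes "x \<in> orb {1..n}" "K \<subseteq> {1..n}" and zero: "\<And>k. k \<in> {1..n} - K \<Longrightarrow> coord k (lam - x) = 0"
  shows "x \<in> orb K"
proof -
  obtain w where w: "w \<in> W K" "dominant_on K (w x)" using ex_dominant[OF assms(2)] .
  have "w \<in> W {1..n}" using W_mono[OF assms(2)] w(1) by blast
  then have orb: "w x \<in> orb {1..n}" using W_orb assms(1) by blast
  have "w x \<bullet> alpha j \<ge> 0" if j: "j \<in> {1..n}" for j
  proof (cases "j \<in> K")
    case True
    with w(2) show ?thesis unfolding dominant_on_def by blast
  next
    case False
    then have "coord j (lam - w x) = 0"
      using zero[of j] j W_coord[OF w(1) assms(2), of j x] by simp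
    then have "(lam - w x) \<bullet> alpha j \<le> 0"
      using inner_alpha_nonpos orb_coord_nonneg[OF orb] j by blast
    moreover have "lam \<bullet> alpha j \<ge> 0" using dominant j unfolding dominant_on_def by blast
    ultimately show ?thesis by (simp add: inner_diff_left)
  qed
  then have dom: "dominant_on {1..n} (w x)" unfolding dominant_on_def by blast
  obtain u where u: "u \<in> W {1..n}" "w x = u lam" using orb unfolding orb_def by blast
  have wx: "w x = lam"
    using dominant_conjugate_stab(1)[OF u(1) _ dominant] dom unfolding u(2) by blast
  obtain w' where w': "w' \<in> W K" "w' \<circ> w = id" using W_inverse[OF w(1)] by metis
  have "x = w' lam" using fun_cong[OF w'(2), of x] unfolding comp_apply wx id_apply by (rule sym)
  with w'(1) show ?thesis unfolding orb_def by blast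
qed

text \<open>The gap \<open>v \<bullet> lam - v \<bullet> x\<close> is a sum of products of
  nonnegative numbers. If it is zero, \<open>lam - x\<close> is supported on the simple roots
  orthogonal to \<open>v\<close>, and \<open>orb_support\<close> applies.\<close>

lemma dominant_max:
  assumes v: "dominant_on {1..n} v" and x: "x \<in> orb {1..n}"
  shows "v \<bullet> x \<le> v \<bullet> lam"
    and "v \<bullet> x = v \<bullet> lam \<Longrightarrow> x \<in> orb {i\<in>{1..n}. v \<bullet> alpha i = 0}"
proof -
  have eq: "v \<bullet> lam - v \<bullet> x = (\<Sum>k\<in>{1..n}. coord k (lam - x) * (alpha k \<bullet> v))"
    unfolding inner_expand[of "lam - x", symmetric] by (simp add: inner_diff_right inner_commute[of _ v])
  have nn: "coord k (lam - x) * (alpha k \<bullet> v) \<ge> 0" if "k \<in> {1..n}" for k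
    using orb_coord_nonneg[OF x _ that] v that by (auto simp: dominant_on_def inner_commute intro: mult_nonneg_nonneg)
  show "v \<bullet> x \<le> v \<bullet> lam" 
    using sum_nonneg[of "{1..n}" "\<lambda>k. coord k (lam - x) * (alpha k \<bullet> v)", OF nn] eq by linarith
  assume "v \<bullet> x = v \<bullet> lam"
  then have "(\<Sum>k\<in>{1..n}. coord k (lam - x) * (alpha k \<bullet> v)) = 0" using eq by linarith
  then have z: "coord k (lam - x) * (alpha k \<bullet> v) = 0" if "k \<in> {1..n}" for k
    using sum_nonneg_eq_0_iff[of "{1..n}" "\<lambda>k. coord k (lam - x) * (alpha k \<bullet> v)"] nn that by blast
  show "x \<in> orb {i\<in>{1..n}. v \<bullet> alpha i = 0}"
  proof (rule orb_support[OF x])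
    fix k assume "k \<in> {1..n} - {i\<in>{1..n}. v \<bullet> alpha i = 0}"
    then show "coord k (lam - x) = 0" using z[of k] by (simp add: inner_commute)
  qed blast
qed

lemma stdface_exposed:
  assumes v: "dominant_on {1..n} v"
  defines "Z \<equiv> {i\<in>{1..n}. v \<bullet> alpha i = 0}"
  shows "x \<in> stdface {1..n} \<Longrightarrow> v \<bullet> x \<le> v \<bullet> lam"
    and "stdface {1..n} \<inter> {x. v \<bullet> x = v \<bullet> lam} face_of stdface {1..n}"
    and "stdface {1..n} \<inter> {x. v \<bullet> x = v \<bullet> lam} = stdface Z"
proof -
  have "stdface {1..n} \<subseteq> {x. v \<bullet> x \<le> v \<bullet> lam}"
    using dominant_max(1)[OF v] by (intro hull_minimal) (auto simp: convex_halfspace_le)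
  then show le: "v \<bullet> x \<le> v \<bullet> lam" if "x \<in> stdface {1..n}" for x using that by blast
  show face: "stdface {1..n} \<inter> {x. v \<bullet> x = v \<bullet> lam} face_of stdface {1..n}"
    using le by (intro face_of_Int_supporting_hyperplane_le) (auto simp: convex_convex_hull)
  \<comment> \<open>A face of the hull of a finite set is the hull of some of its points; by
    \<open>dominant_max\<close> these lie in \<open>orb Z\<close>.\<close>
  have "compact (orb {1..n})" by (intro finite_imp_compact finite_orb) simp
  from face_of_convex_hull_subset[OF this face] obtain S' where
    S': "S' \<subseteq> orb {1..n}" "stdface {1..n} \<inter> {x. v \<bullet> x = v \<bullet> lam} = convex hull S'" .
  have "S' \<subseteq> orb Z"
  proof
    fix x assume x: "x \<in> S'"
    then have "x \<in> convex hull S'" by (rule hull_inc)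
    then have "v \<bullet> x = v \<bullet> lam" unfolding S'(2)[symmetric] by blast
    with dominant_max(2)[OF v] x S'(1) show "x \<in> orb Z" unfolding Z_def by blast
  qed
  moreover have "stdface Z \<subseteq> stdface {1..n} \<inter> {x. v \<bullet> x = v \<bullet> lam}"
  proof (intro hull_minimal Int_greatest)
    show "orb Z \<subseteq> stdface {1..n}" 
      by (rule subset_trans[OF orb_mono hull_subset]) (auto simp: Z_def)
    show "orb Z \<subseteq> {x. v \<bullet> x = v \<bullet> lam}"
    proof
      fix x assume "x \<in> orb Z"
      have "Z \<subseteq> {1..n}" by (auto simp: Z_def)
      from orb_coord_zero[OF \<open>x \<in> orb Z\<close> this]
      \<comment> \<open>On \<open>Z\<close> the vector \<open>v\<close> is orthogonal to
        \<open>alpha k\<close>; off \<open>Z\<close> the coordinate of \<open>lam - x\<close> is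
        zero.\<close>
      have "coord k (lam - x) * (alpha k \<bullet> v) = 0" if "k \<in> {1..n}" for k
        using that by (cases "k \<in> Z") (simp_all add: Z_def inner_commute)
      then have "(lam - x) \<bullet> v = 0" unfolding inner_expand[of "lam - x"] by (rule sum.neutral[OF ballI])
      then show "x \<in> {x. v \<bullet> x = v \<bullet> lam}" by (simp add: inner_diff_left inner_commute[of v])
    qed
    show "convex (stdface {1..n} \<inter> {x. v \<bullet> x = v \<bullet> lam})"
      by (intro convex_Int convex_convex_hull convex_hyperplane)
  qed
  ultimately show "stdface {1..n} \<inter> {x. v \<bullet> x = v \<bullet> lam} = stdface Z"
    unfolding S'(2) using hull_mono by blast
qed

lemma stdface_face_of: "K \<subseteq> {1..n} \<Longrightarrow> stdface K face_of stdface {1..n}"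
  using ex_dominant_zeros[of K] stdface_exposed(2,3) by metis

text \<open>Recovers the orbit from the face, so that an equality of faces becomes one of
  orbits.\<close>

lemma stdface_Int_orb:
  assumes "K \<subseteq> {1..n}"
  shows "stdface K \<inter> orb {1..n} = orb K"
proof
  obtain v where v: "dominant_on {1..n} v" "{i\<in>{1..n}. v \<bullet> alpha i = 0} = K"
    using ex_dominant_zeros[OF assms] .
  show "stdface K \<inter> orb {1..n} \<subseteq> orb K"
    using stdface_exposed(3)[OF v(1)] dominant_max(2)[OF v(1)] unfolding v(2) by blast
  show "orb K \<subseteq> stdface K \<inter> orb {1..n}" 
    using orb_mono[OF assms] hull_subset[of "orb K" convex] by blast
qed

lemma W_stdface:
  assumes "w \<in> W L"
  shows "w ` stdface K = convex hull (w ` orb K)"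
  by (rule convex_hull_linear_image[OF W_linear[OF assms]])

lemma W_image_face_of:
  assumes "w \<in> W {1..n}" "F face_of stdface {1..n}"
  shows "w ` F face_of stdface {1..n}"
proof -
  have "inj w" using W_orthogonal[OF assms(1)] by (rule orthogonal_transformation_inj)
  then have "w ` F face_of w ` stdface {1..n}"
    using face_of_linear_image[OF W_linear[OF assms(1)]] assms(2) by blast
  then show ?thesis unfolding W_stdface[OF assms(1)] W_image_orb[OF assms(1)] .
qed

text \<open>Faces of a polytope are exposed. Moving the normal vector into the dominant chamber
  reduces the claim to \<open>stdface_exposed\<close>.\<close>

lemma face_imp_conjugate:
  assumes "F face_of stdface {1..n}" "F \<noteq> {}"
  obtains w K where "w \<in> W {1..n}" "K \<subseteq> {1..n}" "F = w ` stdface K"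
proof -
  let ?P = "stdface {1..n}"
  have "polyhedron ?P"
    using finite_orb[of "{1..n}"] by (intro polytope_imp_polyhedron) (auto simp: polytope_def)
  then have "F exposed_face_of ?P" using exposed_face_of_polyhedron assms(1) by blast
  then obtain a b where ab: "?P \<subseteq> {x. a \<bullet> x \<le> b}" "F = ?P \<inter> {x. a \<bullet> x = b}"
    unfolding exposed_face_of_def by blast
  obtain w where w: "w \<in> W {1..n}" "dominant_on {1..n} (w a)"
    using ex_dominant[of "{1..n}"] by blast
  let ?v = "w a"
  obtain w' where w': "w' \<in> W {1..n}" "w' \<circ> w = id" "w \<circ> w' = id" using W_inverse[OF w(1)] .
  have ww': "w' (w x) = x" "w (w' x) = x" for x
    using fun_cong[OF w'(2), of x] fun_cong[OF w'(3), of x] by simp_all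
  have inP: "u x \<in> ?P" if "u \<in> W {1..n}" "x \<in> ?P" for u x
    using imageI[OF that(2), of u] unfolding W_stdface[OF that(1)] W_image_orb[OF that(1)] .
  have inner: "?v \<bullet> w x = a \<bullet> x" for x by (rule W_inner[OF w(1)])
  \<comment> \<open>The level \<open>b\<close> is the value of \<open>?v\<close> at
    \<open>lam\<close>: no smaller because \<open>w' lam\<close> lies in the polytope, no larger
    because a point of the nonempty \<open>F\<close> attains it.\<close>
  have "lam \<in> ?P" using lam_in_orb by (rule hull_inc)
  then have "a \<bullet> w' lam \<le> b" using ab(1) inP[OF w'(1)] by blast
  then have 1: "?v \<bullet> lam \<le> b" using inner[of "w' lam"] unfolding ww' by simp
  obtain x0 where "x0 \<in> F" using assms(2) by blast
  then have "w x0 \<in> ?P" "?v \<bullet> w x0 = b" using ab(2) inP[OF w(1)] inner by auto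
  with stdface_exposed(1)[OF w(2)] have "b \<le> ?v \<bullet> lam" by metis
  with 1 have b: "b = ?v \<bullet> lam" by linarith
  define Z where "Z = {i\<in>{1..n}. ?v \<bullet> alpha i = 0}"
  have Z: "?P \<inter> {x. ?v \<bullet> x = b} = stdface Z"
    unfolding b Z_def by (rule stdface_exposed(3)[OF w(2)])
  have "F = w' ` stdface Z"
  proof (intro set_eqI iffI)
    fix x assume "x \<in> F"
    then have "w x \<in> stdface Z" unfolding Z[symmetric] using ab(2) inP[OF w(1)] inner by auto
    then show "x \<in> w' ` stdface Z" using ww'(1)[of x] by (metis imageI)
  next
    fix x assume "x \<in> w' ` stdface Z"
    then obtain y where y: "x = w' y" "y \<in> ?P" "?v \<bullet> y = b" unfolding Z[symmetric] by blast
    then show "x \<in> F" unfolding ab(2) using inP[OF w'(1)] inner[of "w' y"] ww' by auto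
  qed
  then show thesis by (rule that[OF w'(1), rotated]) (auto simp: Z_def)
qed

section \<open>Connected sets\<close>

text \<open>Turns connectedness into an induction: a claim starts at the neighbours of
  \<open>-lam\<close> and spreads along the edges between simple roots.\<close>

lemma ext_connected_induct [consumes 2, case_names base step]:
  assumes "ext_connected alpha lam I" "i \<in> I"
    and base: "\<And>i. i \<in> I \<Longrightarrow> lam \<bullet> alpha i > 0 \<Longrightarrow> Q i"
    and step: "\<And>i j. i \<in> I \<Longrightarrow> j \<in> I \<Longrightarrow> i \<noteq> j \<Longrightarrow> alpha i \<bullet> alpha j \<noteq> 0 \<Longrightarrow> Q i \<Longrightarrow> Q j"
  shows "Q i"
proof -
  define V where "V = insert None (Some ` I)"
  have "(\<lambda>x y. x \<in> V \<and> y \<in> V \<and> ext_adj alpha lam x y)\<^sup>*\<^sup>* None (Some i)"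
    using assms(1,2) unfolding ext_connected_def Let_def V_def by blast
  \<comment> \<open>The extra node carries a trivial claim, so that the induction along the path can
    start there.\<close>
  then have "case Some i of None \<Rightarrow> True | Some k \<Rightarrow> Q k"
  proof (induction rule: rtranclp_induct)
    case base': base
    show ?case by simp
  next
    case step': (step y z)
    show ?case
    proof (cases z)
      case (Some k)
      then have k: "k \<in> I" using step'.hyps(2) by (auto simp: V_def)
      show ?thesis
      proof (cases y)
        case None
        then show ?thesis using step'.hyps(2) Some k base by simp
      next
        case (Some l)
        then have l: "l \<in> I" using step'.hyps(2) by (auto simp: V_def)
        have "l \<noteq> k" "alpha l \<bullet> alpha k \<noteq> 0" "Q l"
          using step'.hyps(2) step'.IH Some \<open>z = Some k\<close> by auto
        with step[OF l k] \<open>z = Some k\<close> show ?thesis by simp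
      qed
    qed simp
  qed
  then show ?thesis by simp
qed

text \<open>Take for \<open>I\<close> the component of \<open>-lam\<close> in \<open>K\<close>. The
  other simple roots of \<open>K\<close> are orthogonal to \<open>lam\<close> and to those of
  \<open>I\<close>, so their reflections fix \<open>orb I\<close> pointwise and do not enlarge the
  orbit.\<close>

lemma ex_conn_set:
  assumes "K \<subseteq> {1..n}"
  obtains I where "I \<in> conn_sets n alpha lam" "orb K = orb I"
proof -
  define V where "V = insert None (Some ` K)"
  define R where "R = (\<lambda>x y. x \<in> V \<and> y \<in> V \<and> ext_adj alpha lam x y)"
  define I where "I = {i\<in>K. R\<^sup>*\<^sup>* None (Some i)}"
  define V' where "V' = insert None (Some ` I)"
  define R' where "R' = (\<lambda>x y. x \<in> V' \<and> y \<in> V' \<and> ext_adj alpha lam x y)"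
  have IK: "I \<subseteq> K" "I \<subseteq> {1..n}" using assms by (auto simp: I_def)
  \<comment> \<open>A path in \<open>K\<close> that starts at the extra node never leaves the
    component, so it is also a path in the smaller diagram.\<close>
  have reach: "x \<in> V' \<and> R'\<^sup>*\<^sup>* None x" if "R\<^sup>*\<^sup>* None x" for x
    using that
  proof (induction rule: rtranclp_induct)
    case base
    show ?case by (simp add: V'_def)
  next
    case (step y z)
    have "R\<^sup>*\<^sup>* None z" using step.hyps by (rule rtranclp.rtrancl_into_rtrancl)
    moreover have "z \<in> V" using step.hyps(2) by (simp add: R_def)
    ultimately have z: "z \<in> V'" by (auto simp: V'_def V_def I_def)
    then have "R' y z" using step by (simp add: R_def R'_def)
    with step.IH z show ?case by (blast intro: rtranclp.rtrancl_into_rtrancl)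
  qed
  have "ext_connected alpha lam I"
    unfolding ext_connected_def Let_def V'_def[symmetric] R'_def[symmetric]
  proof
    fix v assume "v \<in> V'"
    then have "R\<^sup>*\<^sup>* None v" by (auto simp: V'_def I_def)
    then show "R'\<^sup>*\<^sup>* None v" using reach by blast
  qed
  then have conn: "I \<in> conn_sets n alpha lam" using IK unfolding conn_sets_def by blast
  have sep: "lam \<bullet> alpha j = 0" "\<And>i. i \<in> I \<Longrightarrow> alpha i \<bullet> alpha j = 0" if j: "j \<in> K - I" for j
  proof -
    have nr: "\<not> R\<^sup>*\<^sup>* None (Some j)" using j by (auto simp: I_def)
    have "\<not> R None (Some j)" using nr by blast
    then have "\<not> lam \<bullet> alpha j > 0" using j by (simp add: R_def V_def)
    then show "lam \<bullet> alpha j = 0" using dominant j assms unfolding dominant_on_def by force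
    fix i assume i: "i \<in> I"
    then have "\<not> R (Some i) (Some j)" using nr unfolding I_def by (blast intro: rtranclp.rtrancl_into_rtrancl)
    then show "alpha i \<bullet> alpha j = 0" using i j IK by (auto simp: R_def V_def)
  qed
  have "w lam \<in> orb I" if "w \<in> W K" for w
    using that
  proof (induction rule: W_induct)
    case id
    show ?case using lam_in_orb by simp
  next
    case (step j w)
    show ?case
    proof (cases "j \<in> I")
      case True
      from W_orb[OF s_in_W[OF this] step.IH] show ?thesis by simp
    next
      case False
      \<comment> \<open>The difference \<open>lam - w lam\<close> is a combination of simple roots
        from \<open>I\<close>, all orthogonal to \<open>alpha j\<close>.\<close>
      have "coord k (lam - w lam) * (alpha k \<bullet> alpha j) = 0" if k: "k \<in> {1..n}" for k
      proof (cases "k \<in> I")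
        case True
        with sep(2)[of j] step.hyps(1) False show ?thesis by simp
      next
        case False
        with orb_coord_zero[OF step.IH IK(2)] k show ?thesis by simp
      qed
      then have "(lam - w lam) \<bullet> alpha j = 0"
        unfolding inner_expand[of "lam - w lam"] by (rule sum.neutral[OF ballI])
      then have "w lam \<bullet> alpha j = 0" using sep(1)[of j] step.hyps(1) False by (simp add: inner_diff_left)
      from refl_fix[OF this] step.IH show ?thesis by simp
    qed
  qed
  then have "orb K \<subseteq> orb I" unfolding orb_def[of K] by blast
  then have "orb K = orb I" using orb_mono[OF IK(1)] by blast
  with conn show thesis by (rule that)
qed

lemma conn_subset: "I \<in> conn_sets n alpha lam \<Longrightarrow> I \<subseteq> {1..n}"
  and conn_ext_connected: "I \<in> conn_sets n alpha lam \<Longrightarrow> ext_connected alpha lam I"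
  by (simp_all add: conn_sets_def)

text \<open>The differences \<open>x - lam\<close> span the same space as the simple roots of
  \<open>I\<close>. One inclusion is the support condition. For the other, their span is stable
  under each \<open>s i\<close>, contains the neighbours of \<open>-lam\<close>, and gains the other
  roots along the edges.\<close>

lemma aff_dim_stdface:
  assumes "I \<in> conn_sets n alpha lam"
  shows "aff_dim (stdface I) = int (card I)"
proof -
  note I = conn_subset[OF assms]
  let ?A = "(\<lambda>x. x - lam) ` orb I"
  have sA: "s i ` span ?A \<subseteq> span ?A" if i: "i \<in> I" for i
  proof -
    have "s i (x - lam) \<in> span ?A" if "x \<in> orb I" for x
    proof -
      have "s i (x - lam) = (s i x - lam) - (s i lam - lam)"
        by (simp add: linear_diff[OF linear_refl])
      moreover have "s i x - lam \<in> span ?A" "s i lam - lam \<in> span ?A"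
        using W_orb[OF s_in_W[OF i]] that lam_in_orb by (blast intro: span_base)+
      ultimately show ?thesis by (simp only: span_diff)
    qed
    then have "span (s i ` ?A) \<subseteq> span ?A" by (intro span_minimal subspace_span) blast
    then show ?thesis using linear_span_image[OF linear_refl, of "alpha i" ?A] by simp
  qed
  have alphaA: "alpha i \<in> span ?A" if "i \<in> I" for i
    using conn_ext_connected[OF assms] that
  proof (induction rule: ext_connected_induct)
    case (base i)
    have "s i lam - lam \<in> span ?A"
      using W_orb[OF s_in_W[OF base(1)] lam_in_orb] by (intro span_base imageI)
    \<comment> \<open>The scalar inverts the coefficient of \<open>alpha i\<close> in
      \<open>s i lam - lam\<close>, which is nonzero since \<open>alpha i\<close> is a neighbour of
      \<open>-lam\<close>.\<close>
    then have "(- (alpha i \<bullet> alpha i) / (2 * (lam \<bullet> alpha i))) *\<^sub>R (s i lam - lam) \<in> span ?A"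
      by (rule span_scale)
    moreover have "alpha i \<bullet> alpha i \<noteq> 0" "lam \<bullet> alpha i \<noteq> 0" using alpha_inner_pos[of i] base I by auto
    then have "(- (alpha i \<bullet> alpha i) / (2 * (lam \<bullet> alpha i))) *\<^sub>R (s i lam - lam) = alpha i"
      by (simp add: refl_def)
    ultimately show ?case by simp
  next
    case (step i j)
    have "s j (alpha i) - alpha i \<in> span ?A"
      using sA[OF step(2)] step.IH by (intro span_diff) auto
    then have "(- (alpha j \<bullet> alpha j) / (2 * (alpha i \<bullet> alpha j))) *\<^sub>R (s j (alpha i) - alpha i) \<in> span ?A"
      by (rule span_scale)
    moreover have "alpha j \<bullet> alpha j \<noteq> 0" using alpha_inner_pos[of j] step(2) I by auto
    then have "(- (alpha j \<bullet> alpha j) / (2 * (alpha i \<bullet> alpha j))) *\<^sub>R (s j (alpha i) - alpha i) = alpha j"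
      using step(4) by (simp add: refl_def)
    ultimately show ?case by simp
  qed
  have "x - lam \<in> span (alpha ` I)" if x: "x \<in> orb I" for x
  proof -
    have "coord k (x - lam) = 0" if "k \<in> {1..n} - I" for k
      using orb_coord_zero[OF x I that] by simp
    then have "(\<Sum>k\<in>I. coord k (x - lam) *\<^sub>R alpha k) = (\<Sum>k\<in>{1..n}. coord k (x - lam) *\<^sub>R alpha k)"
      using I by (intro sum.mono_neutral_left) auto
    also have "\<dots> = x - lam" by (rule coord_expand[symmetric])
    finally have "x - lam = (\<Sum>k\<in>I. coord k (x - lam) *\<^sub>R alpha k)" ..
    moreover have "(\<Sum>k\<in>I. coord k (x - lam) *\<^sub>R alpha k) \<in> span (alpha ` I)"
      by (intro span_sum span_scale span_base imageI)
    ultimately show ?thesis by (rule ssubst)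
  qed
  then have "span ?A \<subseteq> span (alpha ` I)" by (intro span_minimal subspace_span) blast
  moreover have "span (alpha ` I) \<subseteq> span ?A" using alphaA by (intro span_minimal subspace_span) blast
  ultimately have "dim ?A = dim (alpha ` I)" by (metis dim_span subset_antisym)
  also have "\<dots> = card (alpha ` I)"
    by (rule dim_eq_card_independent[OF independent_mono[OF independent_alpha image_mono[OF I]]])
  also have "\<dots> = card I" by (rule card_image[OF inj_on_subset[OF inj_alpha I]])
  finally have "dim ?A = card I" .
  moreover have "aff_dim (orb I) = int (dim ?A)"
    by (rule aff_dim_eq_dim_subtract[OF hull_inc[OF lam_in_orb]])
  ultimately show ?thesis by (simp add: aff_dim_convex_hull)
qed

section \<open>Centroids of standard faces\<close>

definition centroid :: "nat set \<Rightarrow> 'a" where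
  "centroid K = (1 / real (card (orb K))) *\<^sub>R (\<Sum>x\<in>orb K. x)"

text \<open>Averaging commutes with linear maps, and \<open>u\<close> is injective, so the number of
  points is kept.\<close>

lemma centroid_map:
  assumes "u \<in> W L" "u ` orb K = orb K'"
  shows "u (centroid K) = centroid K'"
proof -
  have inj: "inj_on u (orb K)"
    using orthogonal_transformation_inj[OF W_orthogonal[OF assms(1)]] by (rule inj_on_subset) simp
  then have "card (orb K') = card (orb K)" unfolding assms(2)[symmetric] by (rule card_image)
  moreover have "(\<Sum>x\<in>orb K'. x) = u (\<Sum>x\<in>orb K. x)"
    unfolding assms(2)[symmetric] sum.reindex[OF inj] linear_sum[OF W_linear[OF assms(1)]] by simp
  ultimately show ?thesis unfolding centroid_def by (simp add: linear_scale[OF W_linear[OF assms(1)]])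
qed

text \<open>The reflection \<open>s i\<close> permutes \<open>orb K\<close> and therefore fixes its
  centroid.\<close>

lemma centroid_perp:
  assumes "i \<in> K" "K \<subseteq> {1..n}"
  shows "centroid K \<bullet> alpha i = 0"
proof -
  have "s i (centroid K) = centroid K"
    by (rule centroid_map[OF s_in_W[OF assms(1)] W_image_orb[OF s_in_W[OF assms(1)]]])
  then have "centroid K \<bullet> alpha i = - (centroid K \<bullet> alpha i)"
    using refl_inner_self[of "alpha i" "centroid K"] by simp
  then show ?thesis by simp
qed

text \<open>Carries sign and support of the coordinates over from the points of the orbit to their
  average.\<close>

lemma coord_centroid:
  assumes "K \<subseteq> {1..n}"
  shows "coord k (lam - centroid K) = (1 / real (card (orb K))) * (\<Sum>x\<in>orb K. coord k (lam - x))"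
proof -
  have "card (orb K) > 0" using finite_orb[OF assms] lam_in_orb by (auto simp: card_gt_0_iff)
  then have "(1 / real (card (orb K))) * (\<Sum>x\<in>orb K. coord k (lam - x))
    = coord k lam - (1 / real (card (orb K))) * (\<Sum>x\<in>orb K. coord k x)"
    by (simp add: sum_subtractf field_simps)
  then show ?thesis by (simp add: centroid_def coord_sum)
qed

lemma centroid_coord_nonneg:
  assumes "K \<subseteq> {1..n}" "k \<in> {1..n}"
  shows "coord k (lam - centroid K) \<ge> 0"
  unfolding coord_centroid[OF assms(1)]
  using orb_coord_nonneg[OF _ assms] by (intro mult_nonneg_nonneg sum_nonneg) simp_all

lemma centroid_coord_zero:
  assumes "K \<subseteq> {1..n}" "k \<in> {1..n} - K"
  shows "coord k (lam - centroid K) = 0"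
  unfolding coord_centroid[OF assms(1)]
  using orb_coord_zero[OF _ assms] by simp

lemma centroid_dominant:
  assumes "K \<subseteq> {1..n}"
  shows "dominant_on {1..n} (centroid K)"
  unfolding dominant_on_def
proof
  fix j assume j: "j \<in> {1..n}"
  show "centroid K \<bullet> alpha j \<ge> 0"
  proof (cases "j \<in> K")
    case True
    with centroid_perp assms show ?thesis by simp
  next
    case False
    then have "(lam - centroid K) \<bullet> alpha j \<le> 0"
      using inner_alpha_nonpos[of "lam - centroid K" j] centroid_coord_nonneg[OF assms]
        centroid_coord_zero[OF assms] j by blast
    moreover have "lam \<bullet> alpha j \<ge> 0" using dominant j unfolding dominant_on_def by blast
    ultimately show ?thesis by (simp add: inner_diff_left)
  qed
qed

text \<open>On \<open>I\<close> the difference \<open>lam - centroid I\<close> has the same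
  nonnegative pairings as \<open>lam\<close>. A zero coordinate would make the pairing nonpositive
  at a neighbour of \<open>-lam\<close>, and negative next to a positive coordinate; so positivity
  spreads through the connected set.\<close>

lemma centroid_coord_pos:
  assumes "I \<in> conn_sets n alpha lam" "i \<in> I"
  shows "coord i (lam - centroid I) > 0"
proof -
  note I = conn_subset[OF assms(1)]
  let ?d = "lam - centroid I"
  have d: "?d \<bullet> alpha j = lam \<bullet> alpha j" if "j \<in> I" for j
    using centroid_perp[OF that I] by (simp add: inner_diff_left)
  have pos: "coord j ?d > 0" if "j \<in> I" "\<not> coord j ?d = 0" for j
    using centroid_coord_nonneg[OF I, of j] that I by (simp add: subset_iff less_le)
  show ?thesis
    using conn_ext_connected[OF assms(1)] assms(2)
  proof (induction rule: ext_connected_induct)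
    case (base i)
    have "coord i ?d \<noteq> 0"
    proof
      assume "coord i ?d = 0"
      then have "?d \<bullet> alpha i \<le> 0"
        using inner_alpha_nonpos[of ?d i] centroid_coord_nonneg[OF I] base(1) I by blast
      with d[OF base(1)] base(2) show False by simp
    qed
    with pos base(1) show ?case by blast
  next
    case (step i j)
    have jn: "j \<in> {1..n}" and "i \<in> {1..n}" using step I by auto
    have "coord j ?d \<noteq> 0"
    proof
      assume 0: "coord j ?d = 0"
      have le: "coord k ?d * (alpha k \<bullet> alpha j) \<le> 0" if k: "k \<in> {1..n}" for k
      proof (cases "k = j")
        case True
        with 0 show ?thesis by simp
      next
        case False
        from mult_nonneg_nonpos[OF centroid_coord_nonneg[OF I k] alpha_obtuse[OF k jn this]] show ?thesis .
      qed
      have "alpha i \<bullet> alpha j < 0"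
        using alpha_obtuse[OF \<open>i \<in> {1..n}\<close> jn step(3)] step(4) by simp
      with step.IH have "coord i ?d * (alpha i \<bullet> alpha j) < 0" by (rule mult_pos_neg)
      then have "(\<Sum>k\<in>{1..n}. coord k ?d * (alpha k \<bullet> alpha j)) < (\<Sum>k\<in>{1..n}. 0)"
        using le \<open>i \<in> {1..n}\<close> by (intro sum_strict_mono_ex1) blast+
      then have "?d \<bullet> alpha j < 0" unfolding inner_expand[of ?d] by simp
      moreover have "lam \<bullet> alpha j \<ge> 0" using dominant jn unfolding dominant_on_def by blast
      ultimately show False using d[OF step(2)] by simp
    qed
    with pos step(2) show ?case by blast
  qed
qed

text \<open>For \<open>j\<close> outside \<open>I\<close>, the pairing of the centroid is
  \<open>lam \<bullet> alpha j\<close> minus the nonpositive pairing of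
  \<open>lam - centroid I\<close>, so both must vanish. As the coordinates on \<open>I\<close> are
  positive, the second does so exactly when \<open>alpha j\<close> is orthogonal to all roots of
  \<open>I\<close>.\<close>

lemma centroid_zeros:
  assumes "I \<in> conn_sets n alpha lam"
  shows "{j\<in>{1..n}. centroid I \<bullet> alpha j = 0} = star_set n alpha lam I"
proof -
  note I = conn_subset[OF assms]
  let ?d = "lam - centroid I"
  have "centroid I \<bullet> alpha j = 0 \<longleftrightarrow> lam \<bullet> alpha j = 0 \<and> (\<forall>i\<in>I. alpha j \<bullet> alpha i = 0)"
    if j: "j \<in> {1..n}" "j \<notin> I" for j
  proof -
    have "?d \<bullet> alpha j = (\<Sum>i\<in>I. coord i ?d * (alpha i \<bullet> alpha j))"
      unfolding inner_expand[of ?d] using I centroid_coord_zero[OF I]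
      by (intro sum.mono_neutral_right) auto
    moreover have "coord i ?d * (alpha i \<bullet> alpha j) \<le> 0" if "i \<in> I" for i
    proof -
      have "i \<in> {1..n}" "i \<noteq> j" using that I j by auto
      from mult_nonneg_nonpos[OF centroid_coord_nonneg[OF I this(1)] alpha_obtuse[OF this(1) j(1) this(2)]]
      show ?thesis .
    qed
    moreover have "finite I" using I finite_subset by blast
    ultimately have d: "?d \<bullet> alpha j \<le> 0"
      "?d \<bullet> alpha j = 0 \<longleftrightarrow> (\<forall>i\<in>I. coord i ?d * (alpha i \<bullet> alpha j) = 0)"
      using sum_nonneg_eq_0_iff[of I "\<lambda>i. - (coord i ?d * (alpha i \<bullet> alpha j))"]
      by (simp_all add: sum_nonpos sum_negf del: coord_simps)
    have "(\<forall>i\<in>I. coord i ?d * (alpha i \<bullet> alpha j) = 0) \<longleftrightarrow> (\<forall>i\<in>I. alpha j \<bullet> alpha i = 0)"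
    proof (rule ball_cong)
      fix i assume "i \<in> I"
      from centroid_coord_pos[OF assms this]
      show "(coord i ?d * (alpha i \<bullet> alpha j) = 0) = (alpha j \<bullet> alpha i = 0)"
        by (simp add: inner_commute del: coord_simps)
    qed simp
    moreover have "lam \<bullet> alpha j \<ge> 0" using dominant j unfolding dominant_on_def by blast
    moreover have "centroid I \<bullet> alpha j = lam \<bullet> alpha j - ?d \<bullet> alpha j" by (simp add: inner_diff_left)
    ultimately show ?thesis using d by auto
  qed
  then show ?thesis using I centroid_perp[OF _ I] unfolding star_set_def lam_type_def by blast
qed

lemma star_subset: "I \<in> conn_sets n alpha lam \<Longrightarrow> star_set n alpha lam I \<subseteq> {1..n}"
  unfolding centroid_zeros[symmetric] by blast

text \<open>Generators from \<open>I\<close> permute the orbit; the others are orthogonal to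
  \<open>lam\<close> and to \<open>I\<close> and fix each of its points.\<close>

lemma star_stabilizes:
  assumes I: "I \<in> conn_sets n alpha lam" and "w \<in> W (star_set n alpha lam I)"
  shows "w ` orb I = orb I"
  using assms(2)
proof (induction rule: W_induct)
  case id
  show ?case by simp
next
  case (step j w)
  have "s j ` orb I = orb I"
  proof (cases "j \<in> I")
    case True
    then show ?thesis by (intro W_image_orb s_in_W)
  next
    case False
    then have j: "lam \<bullet> alpha j = 0" "\<And>i. i \<in> I \<Longrightarrow> alpha i \<bullet> alpha j = 0"
      using step.hyps(1) unfolding star_set_def lam_type_def by (auto simp: inner_commute)
    have "s j x = x" if x: "x \<in> orb I" for x
    proof -
      have "coord k (lam - x) * (alpha k \<bullet> alpha j) = 0" if k: "k \<in> {1..n}" for k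
      proof (cases "k \<in> I")
        case True
        from j(2)[OF this] show ?thesis by simp
      next
        case False
        with orb_coord_zero[OF x conn_subset[OF I]] k show ?thesis by simp
      qed
      then have "(lam - x) \<bullet> alpha j = 0" unfolding inner_expand[of "lam - x"] by (rule sum.neutral[OF ballI])
      then have "x \<bullet> alpha j = 0" using j(1) by (simp add: inner_diff_left)
      then show ?thesis by (rule refl_fix)
    qed
    then show ?thesis by (rule image_cong[OF HOL.refl, of _ _ "\<lambda>x. x", simplified])
  qed
  with step.IH show ?case by (simp only: image_comp[symmetric])
qed

text \<open>The two centroids are conjugate and dominant, hence equal. The support of
  \<open>lam - centroid I\<close> gives back \<open>I\<close>, and \<open>w\<close> lies in the
  stabilizer of the centroid, which is parabolic and identified by
  \<open>centroid_zeros\<close>.\<close>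

lemma stdface_conjugate:
  assumes I: "I \<in> conn_sets n alpha lam" and I': "I' \<in> conn_sets n alpha lam"
    and w: "w \<in> W {1..n}" and eq: "w ` stdface I' = stdface I"
  shows "I' = I" "w \<in> W (star_set n alpha lam I)"
proof -
  have "inj w" using W_orthogonal[OF w] by (rule orthogonal_transformation_inj)
  then have "w ` (stdface I' \<inter> orb {1..n}) = w ` stdface I' \<inter> w ` orb {1..n}"
    by (rule image_Int)
  then have "w ` orb I' = orb I"
    unfolding eq W_image_orb[OF w] stdface_Int_orb[OF conn_subset[OF I]] stdface_Int_orb[OF conn_subset[OF I']] .
  then have c: "w (centroid I') = centroid I" by (rule centroid_map[OF w])
  note dom = centroid_dominant[OF conn_subset[OF I]] centroid_dominant[OF conn_subset[OF I']]
  have same: "centroid I' = centroid I"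
    using dominant_conjugate_stab(1)[OF w _ dom(2)] dom(1) unfolding c by simp
  have supp: "K = {k\<in>{1..n}. coord k (lam - centroid K) \<noteq> 0}" if K: "K \<in> conn_sets n alpha lam" for K
    using conn_subset[OF K] centroid_coord_pos[OF K] centroid_coord_zero[OF conn_subset[OF K]] by fastforce
  show "I' = I" using supp[OF I] supp[OF I'] unfolding same by blast
  have "w \<in> W {j\<in>{1..n}. centroid I' \<bullet> alpha j = 0}"
    using dominant_conjugate_stab(2)[OF w _ dom(2)] dom(1) unfolding c by simp
  then show "w \<in> W (star_set n alpha lam I)" unfolding same centroid_zeros[OF I] .
qed

section \<open>Counting faces\<close>

text \<open>Orbit-stabilizer count. The elements that send the face to a given image form a left
  coset of the parabolic subgroup of \<open>star_set n alpha lam I\<close>: one inclusion is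
  \<open>stdface_conjugate\<close>, the other \<open>star_stabilizes\<close>.\<close>

lemma card_conjugates:
  assumes I: "I \<in> conn_sets n alpha lam"
  shows "card ((\<lambda>w. w ` stdface I) ` W {1..n}) * card (W (star_set n alpha lam I)) = card (W {1..n})"
proof -
  let ?h = "\<lambda>w. w ` stdface I"
  have fib: "card {w\<in>W {1..n}. ?h w = F} = card (W (star_set n alpha lam I))"
    if F: "F \<in> ?h ` W {1..n}" for F
  proof -
    obtain u where u: "u \<in> W {1..n}" "F = ?h u" using F by blast
    obtain u' where u': "u' \<in> W {1..n}" "u' \<circ> u = id" "u \<circ> u' = id" using W_inverse[OF u(1)] .
    have "{w\<in>W {1..n}. ?h w = F} = (\<lambda>x. u \<circ> x) ` W (star_set n alpha lam I)"
    proof (intro set_eqI iffI)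
      fix w assume "w \<in> {w\<in>W {1..n}. ?h w = F}"
      then have w: "w \<in> W {1..n}" "w ` stdface I = u ` stdface I" using u(2) by auto
      have "(u' \<circ> w) ` stdface I = (u' \<circ> u) ` stdface I" by (simp only: image_comp[symmetric] w(2))
      then have "(u' \<circ> w) ` stdface I = stdface I" unfolding u'(2) by simp
      from stdface_conjugate(2)[OF I I W_comp[OF u'(1) w(1)] this]
      have "u' \<circ> w \<in> W (star_set n alpha lam I)" .
      moreover have "w = u \<circ> (u' \<circ> w)" unfolding comp_assoc[symmetric] u'(3) by simp
      ultimately show "w \<in> (\<lambda>x. u \<circ> x) ` W (star_set n alpha lam I)" by (intro image_eqI)
    next
      fix w assume "w \<in> (\<lambda>x. u \<circ> x) ` W (star_set n alpha lam I)"
      then obtain x where x: "x \<in> W (star_set n alpha lam I)" "w = u \<circ> x" by blast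
      have xn: "x \<in> W {1..n}" using W_mono[OF star_subset[OF I]] x(1) by blast
      have "x ` stdface I = stdface I" unfolding W_stdface[OF xn] star_stabilizes[OF I x(1)] ..
      then have "w ` stdface I = F" by (simp only: x(2) image_comp[symmetric] u(2))
      moreover have "w \<in> W {1..n}" unfolding x(2) by (rule W_comp[OF u(1) xn])
      ultimately show "w \<in> {w\<in>W {1..n}. ?h w = F}" by blast
    qed
    moreover have "inj_on (\<lambda>x. u \<circ> x) (W (star_set n alpha lam I))"
    proof (rule inj_onI)
      fix x y assume "u \<circ> x = u \<circ> y"
      then have "(u' \<circ> u) \<circ> x = (u' \<circ> u) \<circ> y" by (simp only: comp_assoc)
      then show "x = y" unfolding u'(2) by simp
    qed
    ultimately show ?thesis by (simp only: card_image)
  qed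
  have "card (W {1..n}) = (\<Sum>w\<in>W {1..n}. 1)" by simp
  also have "\<dots> = (\<Sum>F\<in>?h ` W {1..n}. \<Sum>w\<in>{w\<in>W {1..n}. ?h w = F}. 1)"
    by (rule sum.image_gen[OF finite_W]) simp
  also have "\<dots> = (\<Sum>F\<in>?h ` W {1..n}. card (W (star_set n alpha lam I)))"
    by (rule sum.cong[OF HOL.refl]) (simp add: fib)
  also have "\<dots> = card (?h ` W {1..n}) * card (W (star_set n alpha lam I))" by simp
  finally show ?thesis ..
qed

lemma faces_eq:
  "{F. F face_of stdface {1..n} \<and> aff_dim F = int k} =
    (\<Union>I\<in>{I\<in>conn_sets n alpha lam. card I = k}. (\<lambda>w. w ` stdface I) ` W {1..n})"
  (is "?L = ?R")
proof -
  have dim: "aff_dim (w ` stdface I) = int (card I)" if "I \<in> conn_sets n alpha lam" "w \<in> W {1..n}" for w I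
    using aff_dim_injective_linear_image[OF W_linear[OF that(2)] orthogonal_transformation_inj[OF W_orthogonal[OF that(2)]]]
      aff_dim_stdface[OF that(1)] by simp
  show ?thesis
  proof (intro set_eqI iffI)
    fix F assume "F \<in> ?L"
    then have F: "F face_of stdface {1..n}" "aff_dim F = int k" by auto
    \<comment> \<open>The empty face has affine dimension -1, so no natural \<open>k\<close> counts
      it.\<close>
    then have "F \<noteq> {}" by auto
    from face_imp_conjugate[OF F(1) this] obtain w K where
      w: "w \<in> W {1..n}" "K \<subseteq> {1..n}" "F = w ` stdface K" .
    from ex_conn_set[OF w(2)] obtain I where I: "I \<in> conn_sets n alpha lam" "orb K = orb I" .
    have "F = w ` stdface I" unfolding w(3) I(2) ..
    moreover from this have "card I = k" using dim[OF I(1) w(1)] F(2) by simp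
    ultimately show "F \<in> ?R" using I(1) w(1) by blast
  next
    fix F assume "F \<in> ?R"
    then obtain I w where I: "I \<in> conn_sets n alpha lam" "card I = k" and w: "w \<in> W {1..n}" "F = w ` stdface I"
      by blast
    then show "F \<in> ?L"
      using W_image_face_of[OF w(1) stdface_face_of[OF conn_subset[OF I(1)]]] dim[OF I(1) w(1)] by simp
  qed
qed

lemma finite_conn_sets: "finite (conn_sets n alpha lam)"
  by (rule finite_subset[of _ "Pow {1..n}"]) (auto simp: conn_sets_def)

text \<open>Orbits of faces for different connected sets are disjoint by
  \<open>stdface_conjugate\<close>, so their sizes add up.\<close>

lemma card_faces:
  "real (card {F. F face_of stdface {1..n} \<and> aff_dim F = int k}) =
    (\<Sum>I\<in>{I\<in>conn_sets n alpha lam. card I = k}.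
      real (card (W {1..n})) / real (card (W (star_set n alpha lam I))))"
proof -
  let ?C = "{I\<in>conn_sets n alpha lam. card I = k}"
  have disj: "((\<lambda>w. w ` stdface I) ` W {1..n}) \<inter> ((\<lambda>w. w ` stdface I') ` W {1..n}) = {}"
    if "I \<in> ?C" "I' \<in> ?C" "I \<noteq> I'" for I I'
  proof (rule ccontr)
    assume "\<not> ?thesis"
    then obtain u w where uw: "u \<in> W {1..n}" "w \<in> W {1..n}" "u ` stdface I = w ` stdface I'" by blast
    obtain u' where u': "u' \<in> W {1..n}" "u' \<circ> u = id" using W_inverse[OF uw(1)] by metis
    have "(u' \<circ> w) ` stdface I' = (u' \<circ> u) ` stdface I" by (simp only: image_comp[symmetric] uw(3))
    then have "(u' \<circ> w) ` stdface I' = stdface I" unfolding u'(2) by simp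
    from stdface_conjugate(1)[OF _ _ W_comp[OF u'(1) uw(2)] this] that show False by blast
  qed
  have "card {F. F face_of stdface {1..n} \<and> aff_dim F = int k}
      = (\<Sum>I\<in>?C. card ((\<lambda>w. w ` stdface I) ` W {1..n}))"
    unfolding faces_eq
  proof (rule card_UN_disjoint)
    show "finite ?C" using finite_conn_sets by simp
    show "\<forall>I\<in>?C. finite ((\<lambda>w. w ` stdface I) ` W {1..n})" using finite_W[of "{1..n}"] by blast
    show "\<forall>I\<in>?C. \<forall>I'\<in>?C. I \<noteq> I' \<longrightarrow>
        (\<lambda>w. w ` stdface I) ` W {1..n} \<inter> (\<lambda>w. w ` stdface I') ` W {1..n} = {}"
      using disj by blast
  qed
  then have "real (card {F. F face_of stdface {1..n} \<and> aff_dim F = int k})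
      = (\<Sum>I\<in>?C. real (card ((\<lambda>w. w ` stdface I) ` W {1..n})))" by simp
  also have "\<dots> = (\<Sum>I\<in>?C. real (card (W {1..n})) / real (card (W (star_set n alpha lam I))))"
  proof (rule sum.cong[OF HOL.refl])
    fix I assume "I \<in> ?C"
    then have I: "I \<in> conn_sets n alpha lam" by blast
    have "card (W (star_set n alpha lam I)) \<noteq> 0"
      using finite_W[OF star_subset[OF I]] id_W by (metis card_eq_0_iff empty_iff)
    moreover have "real (card ((\<lambda>w. w ` stdface I) ` W {1..n})) * real (card (W (star_set n alpha lam I)))
        = real (card (W {1..n}))"
      using card_conjugates[OF I] by (metis of_nat_mult)
    ultimately show "real (card ((\<lambda>w. w ` stdface I) ` W {1..n}))
        = real (card (W {1..n})) / real (card (W (star_set n alpha lam I)))"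
      by (simp add: nonzero_eq_divide_eq)
  qed
  finally show ?thesis .
qed

text \<open>Matches the degree bound in \<open>f_poly\<close> with the size of the base, so that
  every \<open>card I\<close> falls into the range of summation.\<close>

lemma rank_eq: "n = DIM('a)"
proof -
  have "dim (alpha ` {1..n}) = card (alpha ` {1..n})"
    by (rule dim_eq_card_independent[OF independent_alpha])
  also have "\<dots> = n" by (simp add: card_image[OF inj_alpha])
  finally show ?thesis using dim_span[of "alpha ` {1..n}"] unfolding span_alpha by simp
qed

lemma f_poly_stdface:
  "f_poly (stdface {1..n}) = (\<Sum>I\<in>conn_sets n alpha lam.
     monom (real (card (W {1..n})) / real (card (W (star_set n alpha lam I)))) (card I))"
  (is "_ = sum ?m _")
proof -
  have "f_poly (stdface {1..n}) = (\<Sum>k\<in>{..n}. \<Sum>I\<in>{I\<in>conn_sets n alpha lam. card I = k}. ?m I)"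
    unfolding f_poly_def rank_eq[symmetric]
  proof (rule sum.cong[OF HOL.refl])
    fix k
    show "monom (real (card {F. F face_of stdface {1..n} \<and> aff_dim F = int k})) k
        = (\<Sum>I\<in>{I\<in>conn_sets n alpha lam. card I = k}. ?m I)"
      unfolding card_faces monom_sum by (rule sum.cong) simp_all
  qed
  also have "\<dots> = sum ?m (conn_sets n alpha lam)"
  proof (rule sum.group[OF finite_conn_sets])
    show "card ` conn_sets n alpha lam \<subseteq> {..n}"
      using card_mono[OF finite_atLeastAtMost conn_subset] by fastforce
  qed simp
  finally show ?thesis .
qed

end

theorem theorem4p16:
  fixes \<Phi> :: "'a::euclidean_space set" and n :: nat and alpha :: "nat \<Rightarrow> 'a" and lam :: 'a
  assumes "root_system \<Phi>" and "irreducible_rs \<Phi>"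
    and "is_base \<Phi> n alpha"
    and "dominant_integral n alpha lam"
  shows "f_poly (weight_polytope \<Phi> lam) =
    (\<Sum>I\<in>conn_sets n alpha lam.
       monom (real (card (weyl_group \<Phi>)) / real (card (parabolic alpha (star_set n alpha lam I)))) (card I))"
proof -
  interpret based_root_system \<Phi> n alpha
    using assms by unfold_locales
  have "dominant_on {1..n} lam"
    unfolding dominant_on_def
  proof
    fix i assume i: "i \<in> {1..n}"
    then obtain m :: nat where "2 * (lam \<bullet> alpha i) / (alpha i \<bullet> alpha i) = real m"
      using assms(4) unfolding dominant_integral_def by blast
    then have "2 * (lam \<bullet> alpha i) = real m * (alpha i \<bullet> alpha i)"
      using alpha_inner_pos[OF i] by (simp add: field_simps)
    moreover have "real m * (alpha i \<bullet> alpha i) \<ge> 0" by simp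
    ultimately show "lam \<bullet> alpha i \<ge> 0" by linarith
  qed
  then interpret dominant_weight \<Phi> n alpha lam
    by unfold_locales
  have "weight_polytope \<Phi> lam = stdface {1..n}"
    unfolding weight_polytope_def weyl_group_eq orb_def ..
  then show ?thesis using f_poly_stdface unfolding weyl_group_eq by simp
qed

end
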